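(* Let $A$ be one of the algebras $\mathbb{C}$ (complex numbers), $\mathbb{C}^1$ (double numbers), $\mathbb{C}^0$ (dual numbers), let $\gamma$ be an $A$-smooth line in the projective plane $AP^2$, and let $S\subset\mathbb{R}P^5$ be the ruled three-dimensional submanifold corresponding to $\gamma$, formed by the two-parameter family of straight lines corresponding to the points of $\gamma$. Then the tangent subspace $T_x(S)$ is fixed at all points $x$ of each rectilinear generator $L$ of $S$, and the submanifold $S$ is tangentially degenerate of rank $r=2$.
   Context: **Algebras.** $\mathbb{C}=\{x+iy\}$ with $i^2=-1$, $\mathbb{C}^1=\{x+ey\}$ with $e^2=1$, $\mathbb{C}^0=\{x+\varepsilon y\}$ with $\varepsilon^2=0$, where $x,y\in\mathbb{R}$. They are identified with algebras of real $(2\times 2)$-matrices by $$x+iy\mapsto\begin{pmatrix}x&-y\\ y&x\end{pmatrix},\qquad x+ey\mapsto\begin{pmatrix}x&y\\ y&x\end{pmatrix},\qquad x+\varepsilon y\mapsto\begin{pmatrix}x&0\\ y&x\end{pmatrix}.$$ **Projective plane $AP^2$.** A point $X\in AP^2$ is given by three coordinates $X^0,X^1,X^2\in A$, written as a column $X=(X^0,X^1,X^2)^T$, which in the matrix representation is a real $(6\times2)$-matrix; its two columns $x_0,x_1\in\mathbb{R}^6$ are required to be linearly independent. The coordinates are defined up to simultaneous multiplication from the right by an element of $A$ which is not a zero divisor. The plane $AP^2$ has real dimension 4. To $X$ there corresponds the straight line $x_0\wedge x_1$ of $\mathbb{R}P^5$ through the points $x_0,x_1$. Two points $X,Y$ are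 adjacent if the $(6\times4)$-matrix composed of their coordinates has rank less than 4; through two non-adjacent points there passes a unique straight line $X\wedge Y=\{XP+YQ : P,Q\in A\}\cap AP^2$, which has real dimension 2 and corresponds to a 3-dimensional subspace $\mathbb{R}P^3\subset\mathbb{R}P^5$. **$A$-smooth line.** An $A$-smooth line is a smooth submanifold $\gamma\subset AP^2$ of real dimension 2 such that at each of its points $X$ it is tangent to a straight line $U$ of $AP^2$ passing through $X$ (i.e. $T_X\gamma=T_XU$). **Ruled submanifold $S$.** $S$ is the union of the lines $x_0\wedge x_1\subset\mathbb{R}P^5$ corresponding to points $X\in\gamma$; these lines are its rectilinear generators. It is the image of a map from a 3-dimensional manifold (the total space of the family of lines over $\gamma$). The tangent subspace $T_x(S)$ is the projective tangent 3-space of $S$ at a point $x$ where this map has rank 3 (a regular point of $S$). **Tangential degeneracy.** A three-dimensional submanifold $S\subset\mathbb{R}P^5$ is tangentially degenerate of rank $r$ (a submanifold with degenerate Gauss map of rank $r$) if its Gauss map $x\mapsto T_x(S)$, from the regular points of $S$ to the Grassmannian of 3-dimensional subspaces of $\mathbb{R}P^5$, has rank equal to $r$, where $r<3$; thus the tangent subspaces of $S$ form a family depending on exactly $r$ parameters.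
   Formalization: Rank r = 2 fails for some A-smooth lines (a straight line γ gives rank 0); what is proved is rank at most 2 always, and rank exactly 2 at all regular points if and only if γ has no inflection point; T_x(S) is taken at regular points of each generator. *)

theory Defs
  imports "HOL-Analysis.Analysis"
begin

section \<open>The algebras, as algebras of real 2 by 2 matrices\<close>

definition alg_C :: "(real^2^2) set" where
  "alg_C = {vector [vector [x, - y], vector [y, x]] | x y. True}"

definition alg_C1 :: "(real^2^2) set" where
  "alg_C1 = {vector [vector [x, y], vector [y, x]] | x y. True}"

definition alg_C0 :: "(real^2^2) set" where
  "alg_C0 = {vector [vector [x, 0], vector [y, x]] | x y. True}"

definition not_zero_divisor :: "(real^2^2) set \<Rightarrow> real^2^2 \<Rightarrow> bool" where
  "not_zero_divisor A P \<longleftrightarrow> P \<in> A \<and> (\<forall>Q\<in>A. P ** Q = 0 \<longrightarrow> Q = 0)"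


section \<open>The projective plane over an algebra\<close>

text \<open>A coordinate column is a triple of 2 by 2 matrices, i.e. a 6 by 2 matrix in three blocks.
  Correspondingly the six-dimensional real space is \<open>real^2^3\<close>: three blocks of two coordinates.\<close>

type_synonym coord = "real^2^2^3"
type_synonym R6 = "real^2^3"

definition col :: "2 \<Rightarrow> coord \<Rightarrow> R6" where
  "col j X = (\<chi> i. column j (X $ i))"

definition cols :: "coord \<Rightarrow> R6 set" where
  "cols X = {col 1 X, col 2 X}"

definition rmult :: "coord \<Rightarrow> real^2^2 \<Rightarrow> coord" where
  "rmult X P = (\<chi> i. X $ i ** P)"

text \<open>The combination of the two columns of \<open>X\<close> with coefficients \<open>s $ 1\<close> and \<open>s $ 2\<close>.\<close>

definition act :: "coord \<Rightarrow> real^2 \<Rightarrow> R6" where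
  "act X s = (\<chi> i. X $ i *v s)"

definition coords :: "(real^2^2) set \<Rightarrow> coord set" where
  "coords A = {X. (\<forall>i. X $ i \<in> A) \<and> col 1 X \<noteq> col 2 X \<and> independent (cols X)}"

definition point :: "(real^2^2) set \<Rightarrow> coord \<Rightarrow> coord set" where
  "point A X = {rmult X P | P. not_zero_divisor A P}"

definition AP2 :: "(real^2^2) set \<Rightarrow> coord set set" where
  "AP2 A = point A ` coords A"

text \<open>All coordinate columns of all points of a set \<open>M\<close> of the plane.\<close>

definition cone :: "(real^2^2) set \<Rightarrow> coord set set \<Rightarrow> coord set" where
  "cone A M = {X \<in> coords A. point A X \<in> M}"

definition adjacent :: "coord \<Rightarrow> coord \<Rightarrow> bool" where
  "adjacent X Y \<longleftrightarrow> dim (cols X \<union> cols Y) < 4"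

definition straight_line :: "(real^2^2) set \<Rightarrow> coord \<Rightarrow> coord \<Rightarrow> coord set set" where
  "straight_line A X Y = point A ` ({rmult X P + rmult Y Q | P Q. P \<in> A \<and> Q \<in> A} \<inter> coords A)"

definition straight_lines :: "(real^2^2) set \<Rightarrow> coord set set set" where
  "straight_lines A =
     {straight_line A X Y | X Y. X \<in> coords A \<and> Y \<in> coords A \<and> \<not> adjacent X Y}"

definition AP2_topology :: "(real^2^2) set \<Rightarrow> coord set topology" where
  "AP2_topology A =
     topology (\<lambda>V. V \<subseteq> AP2 A \<and> openin (top_of_set (coords A)) (cone A V))"

lemma istopology_AP2:
  "istopology (\<lambda>V. V \<subseteq> AP2 A \<and> openin (top_of_set (coords A)) (cone A V))"
proof -
  have inter: "cone A (S \<inter> T) = cone A S \<inter> cone A T" for S T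
    by (auto simp: cone_def)
  have union: "cone A (\<Union>K) = \<Union>(cone A ` K)" for K
    by (auto simp: cone_def)
  show ?thesis
    unfolding istopology_def inter union
    by (auto intro!: openin_Union)
qed

lemma openin_AP2_topology:
  "openin (AP2_topology A) V \<longleftrightarrow> V \<subseteq> AP2 A \<and> openin (top_of_set (coords A)) (cone A V)"
  unfolding AP2_topology_def by (simp add: istopology_AP2)

lemma topspace_AP2_topology: "topspace (AP2_topology A) = AP2 A"
proof -
  have "cone A (AP2 A) = coords A"
    by (auto simp: cone_def AP2_def)
  then have "openin (AP2_topology A) (AP2 A)"
    by (simp add: openin_AP2_topology)
  then show ?thesis
    by (meson openin_AP2_topology openin_subset openin_topspace subset_antisym)
qed

lemma quotient_map_point: "quotient_map (top_of_set (coords A)) (AP2_topology A) (point A)"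
  unfolding quotient_map_def
  by (auto simp: topspace_AP2_topology openin_AP2_topology AP2_def cone_def)


section \<open>Smooth surfaces in the plane, tangency\<close>

fun Ck_on :: "nat \<Rightarrow> 'a::real_normed_vector set \<Rightarrow> ('a \<Rightarrow> 'b::real_normed_vector) \<Rightarrow> bool" where
  "Ck_on 0 U f \<longleftrightarrow> continuous_on U f"
| "Ck_on (Suc k) U f \<longleftrightarrow>
     (\<forall>x\<in>U. f differentiable (at x)) \<and> (\<forall>v. Ck_on k U (\<lambda>x. frechet_derivative f (at x) v))"

definition smooth_on :: "'a::real_normed_vector set \<Rightarrow> ('a \<Rightarrow> 'b::real_normed_vector) \<Rightarrow> bool" where
  "smooth_on U f \<longleftrightarrow> (\<forall>k. Ck_on k U f)"

text \<open>A local parametrization of \<open>\<gamma>\<close>, given by a smooth choice \<open>F\<close> of coordinates. The tangent space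
  of the plane at the point of \<open>X\<close> is the space of triples over \<open>A\<close> modulo the multiples of \<open>X\<close>
  (the directions of rescaling), so the fourth condition says that \<open>point A \<circ> F\<close> is an
  immersion.\<close>

definition local_param ::
  "(real^2^2) set \<Rightarrow> coord set set \<Rightarrow> (real^2) set \<Rightarrow> (real^2 \<Rightarrow> coord) \<Rightarrow> bool" where
  "local_param A \<gamma> U F \<longleftrightarrow>
     open U \<and> smooth_on U F \<and> F ` U \<subseteq> coords A \<and>
     (\<forall>u\<in>U. \<forall>v. v \<noteq> 0 \<longrightarrow> frechet_derivative F (at u) v \<notin> {rmult (F u) P | P. P \<in> A}) \<and>
     embedding_map (top_of_set U) (AP2_topology A) (point A \<circ> F) \<and>
     openin (subtopology (AP2_topology A) \<gamma>) ((point A \<circ> F) ` U)"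

definition smooth_surface :: "(real^2^2) set \<Rightarrow> coord set set \<Rightarrow> bool" where
  "smooth_surface A \<gamma> \<longleftrightarrow>
     \<gamma> \<subseteq> AP2 A \<and> (\<forall>p\<in>\<gamma>. \<exists>U F. local_param A \<gamma> U F \<and> p \<in> (point A \<circ> F) ` U)"

text \<open>Velocities of the lifted curves through \<open>X\<close> that run in \<open>M\<close>. This is the full preimage, in the
  space of triples over \<open>A\<close>, of the tangent space of \<open>M\<close> at the point of \<open>X\<close>; it contains the
  multiples of \<open>X\<close>, so two such preimages agree iff the tangent spaces themselves agree.\<close>

definition tangent_space :: "(real^2^2) set \<Rightarrow> coord set set \<Rightarrow> coord \<Rightarrow> coord set" where
  "tangent_space A M X =
     {w. \<exists>c :: real \<Rightarrow> coord. c 0 = X \<and> (\<forall>\<^sub>F t in nhds 0. c t \<in> cone A M) \<and>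
         (c has_vector_derivative w) (at 0)}"

definition A_smooth_line :: "(real^2^2) set \<Rightarrow> coord set set \<Rightarrow> bool" where
  "A_smooth_line A \<gamma> \<longleftrightarrow>
     smooth_surface A \<gamma> \<and>
     (\<forall>X\<in>cone A \<gamma>. \<exists>L\<in>straight_lines A.
        point A X \<in> L \<and> tangent_space A \<gamma> X = tangent_space A L X)"

text \<open>A point \<open>p\<close> of \<open>\<gamma>\<close> at which coordinates and their first and second derivatives in a direction
  never form a nonsingular 6 by 6 matrix. Over a field this is the usual vanishing of the
  determinant of \<open>X, X', X''\<close>; in general that determinant is zero or a zero divisor.\<close>

definition inflection_point :: "(real^2^2) set \<Rightarrow> coord set set \<Rightarrow> coord set \<Rightarrow> bool" where
  "inflection_point A \<gamma> p \<longleftrightarrow>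
     p \<in> \<gamma> \<and>
     \<not> (\<exists>U F u v. local_param A \<gamma> U F \<and> u \<in> U \<and> point A (F u) = p \<and>
          dim (cols (F u)
             \<union> cols (frechet_derivative F (at u) v)
             \<union> cols (frechet_derivative (\<lambda>w. frechet_derivative F (at w) v) (at u) v)) = 6)"


section \<open>The ruled submanifold and its Gauss map\<close>

text \<open>The point of real projective 5-space with homogeneous coordinates \<open>x \<noteq> 0\<close>. Projective
  3-subspaces are represented by linear subspaces of dimension 4.\<close>

definition rp :: "R6 \<Rightarrow> R6 set" where
  "rp x = span {x}"

text \<open>The straight line through the points given by the two columns of \<open>X\<close>.\<close>

definition generator :: "coord \<Rightarrow> R6 set set" where
  "generator X = {rp (act X s) | s. s \<noteq> 0}"

definition generators :: "(real^2^2) set \<Rightarrow> coord set set \<Rightarrow> R6 set set set" where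
  "generators A \<gamma> = generator ` cone A \<gamma>"

definition ruled :: "(real^2^2) set \<Rightarrow> coord set set \<Rightarrow> R6 set set" where
  "ruled A \<gamma> = \<Union>(generators A \<gamma>)"

text \<open>\<open>x\<close> is a regular point of the ruled submanifold with tangent 3-space \<open>T\<close>. The map \<open>act (F u) s\<close>
  describes the submanifold in homogeneous coordinates; being linear in \<open>s\<close>, its differential
  has rank one more than that of the induced map into projective space, hence 4 instead of 3,
  and the range of the differential is the linear subspace over the projective tangent
  space.\<close>

definition has_tangent :: "(real^2^2) set \<Rightarrow> coord set set \<Rightarrow> R6 set \<Rightarrow> R6 set \<Rightarrow> bool" where
  "has_tangent A \<gamma> x T \<longleftrightarrow>
     (\<exists>U F u s D. local_param A \<gamma> U F \<and> u \<in> U \<and> s \<noteq> 0 \<and> x = rp (act (F u) s) \<and>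
        ((\<lambda>(u, s). act (F u) s) has_derivative D) (at (u, s)) \<and>
        T = range D \<and> dim T = 4)"

definition regular_point :: "(real^2^2) set \<Rightarrow> coord set set \<Rightarrow> R6 set \<Rightarrow> bool" where
  "regular_point A \<gamma> x \<longleftrightarrow> (\<exists>T. has_tangent A \<gamma> x T)"

definition gauss :: "(real^2^2) set \<Rightarrow> coord set set \<Rightarrow> R6 set \<Rightarrow> R6 set" where
  "gauss A \<gamma> x = (THE T. has_tangent A \<gamma> x T)"

text \<open>The Grassmannian is embedded in the space of linear operators by sending a subspace to the
  orthogonal projection onto it.\<close>

definition orth_proj :: "R6 set \<Rightarrow> R6 \<Rightarrow>\<^sub>L R6" where
  "orth_proj W = Blinfun (closest_point W)"

text \<open>The Gauss map is differentiable at \<open>x\<close> with differential of rank \<open>r\<close>. It is written in the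
  coordinates \<open>(u, s)\<close>; the superfluous coordinate (scaling of \<open>s\<close>) does not change \<open>x\<close> and so
  does not contribute to the rank.\<close>

definition gauss_rank :: "(real^2^2) set \<Rightarrow> coord set set \<Rightarrow> R6 set \<Rightarrow> nat \<Rightarrow> bool" where
  "gauss_rank A \<gamma> x r \<longleftrightarrow>
     (\<exists>U F u s D. local_param A \<gamma> U F \<and> u \<in> U \<and> s \<noteq> 0 \<and> x = rp (act (F u) s) \<and>
        ((\<lambda>(u, s). orth_proj (gauss A \<gamma> (rp (act (F u) s)))) has_derivative D) (at (u, s)) \<and>
        dim (range D) = r)"

definition three_dimensional :: "(real^2^2) set \<Rightarrow> coord set set \<Rightarrow> bool" where
  "three_dimensional A \<gamma> \<longleftrightarrow> (\<forall>L\<in>generators A \<gamma>. \<exists>x\<in>L. regular_point A \<gamma> x)"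

definition tangentially_degenerate :: "(real^2^2) set \<Rightarrow> coord set set \<Rightarrow> nat \<Rightarrow> bool" where
  "tangentially_degenerate A \<gamma> r \<longleftrightarrow>
     three_dimensional A \<gamma> \<and> r < 3 \<and>
     (\<forall>x\<in>ruled A \<gamma>. regular_point A \<gamma> x \<longrightarrow> gauss_rank A \<gamma> x r)"

end

theory Submission
  imports Defs
begin

text \<open>
  The complex, double and dual numbers enter only through what they share: each is a
  two-dimensional commutative algebra \<open>A\<close> of real matrices whose elements correspond bijectively to their
  first columns (locale \<open>plane_algebra\<close>). So triples over \<open>A\<close> correspond to vectors of
  six-dimensional space, the span of the two columns of \<open>X\<close> to the module \<open>X A\<close>, and a position \<open>s\<close> on a
  generator to an element of \<open>A\<close>.

  Let \<open>F\<close> be a local parametrization with differential \<open>dF\<close> at \<open>u\<close>. Lifted to triples, the tangent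
  space of \<open>\<gamma>\<close> is \<open>V = F A + dF(\<real>\<^sup>2)\<close>, of real dimension four. Tangency to a straight line means that
  \<open>V\<close> is an \<open>A\<close>-module (\<open>tangent_space_is_module\<close>), and it is free with basis \<open>F\<close>, \<open>dF w\<close> for a
  suitable \<open>w\<close> (\<open>tangent_frame_exists\<close>). The tangent space of the ruled submanifold at the position \<open>s\<close> is
  \<open>F \<real>\<^sup>2 + dF(\<real>\<^sup>2) s\<close>. If \<open>s\<close> is invertible in \<open>A\<close>, the module property turns this into the span of the
  columns of \<open>V\<close>, in which \<open>s\<close> no longer occurs (\<open>ruled_map_range_unit\<close>). If \<open>s\<close> is a zero divisor, the
  dimension drops and the point is not regular (\<open>ruled_map_range_nonunit\<close>). A point at an invertible
  position lies on a single generator (\<open>unit_position_determines_point\<close>), so the tangent space is constant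
  along generators.

  Consequently the Gauss map factors through \<open>u\<close> and has rank at most two. Its differential annihilates \<open>v\<close>
  iff the second derivatives \<open>H v w\<close> of \<open>F\<close> lie in \<open>V\<close> for all \<open>w\<close> (\<open>gauss_kernel_iff\<close>). Differentiating the
  module property shows that \<open>H\<close> modulo \<open>V\<close> is \<open>A\<close>-linear in \<open>w\<close> (\<open>second_derivative_A_linear\<close>), hence
  \<open>A\<close>-bilinear by symmetry. As \<open>V\<close> modulo \<open>F A\<close> is generated by \<open>dF w\<close>, the form \<open>H\<close> is determined by the
  single value \<open>H w w\<close>, and the rank is two iff this value generates the quotient by \<open>V\<close>, that is, iff \<open>F\<close>,
  \<open>dF w\<close> and \<open>H w w\<close> together have rank six and the point is not an inflection
  (\<open>gauss_injective_iff_curved\<close>).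
\<close>

section \<open>Rank of linear maps\<close>

lemma
  fixes f :: "'a::euclidean_space \<Rightarrow> 'b::real_vector"
  assumes lin: "linear f"
  shows dim_range_full_iff_inj: "dim (range f) = DIM('a) \<longleftrightarrow> (\<forall>z. f z = 0 \<longrightarrow> z = 0)"
    and dim_range_le: "dim (range f) \<le> DIM('a)"
proof -
  have range_span: "range f = span (f ` Basis)"
    using linear_span_image[OF lin, of Basis] by simp
  then have "dim (range f) \<le> card (f ` Basis)"
    by (intro dim_le_card) auto
  also have "\<dots> \<le> DIM('a)" by (rule card_image_le) simp
  finally show "dim (range f) \<le> DIM('a)" .
  show "dim (range f) = DIM('a) \<longleftrightarrow> (\<forall>z. f z = 0 \<longrightarrow> z = 0)"
  proof
    assume full: "dim (range f) = DIM('a)"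
    show "\<forall>z. f z = 0 \<longrightarrow> z = 0"
    proof (intro allI impI, rule ccontr)
      fix z assume z: "f z = 0" "z \<noteq> 0"
      \<comment> \<open>If \<open>f\<close> kills \<open>z\<close>, the hyperplane orthogonal to \<open>z\<close> already has the full image.\<close>
      obtain B where B: "independent B" "{y. z \<bullet> y = 0} \<subseteq> span B" "card B = dim {y. z \<bullet> y = 0}"
        using basis_exists[of "{y. z \<bullet> y = 0}"] by metis
      then have fin: "finite B" using independent_imp_finite by blast
      have "range f \<subseteq> span (f ` B)"
      proof clarify
        fix x
        have "f x = f (x - ((z \<bullet> x) / (z \<bullet> z)) *\<^sub>R z)"
          using z lin by (simp add: linear_diff linear_scale)
        moreover have "z \<bullet> (x - ((z \<bullet> x) / (z \<bullet> z)) *\<^sub>R z) = 0"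
          using z by (simp add: inner_diff_right)
        ultimately show "f x \<in> span (f ` B)"
          using B linear_span_image[OF lin, of B] by auto
      qed
      then have "dim (range f) \<le> card (f ` B)" using fin by (intro dim_le_card) auto
      also have "\<dots> \<le> card B" by (rule card_image_le[OF fin])
      also have "\<dots> < DIM('a)" using z B by (simp add: dim_hyperplane)
      finally show False using full by simp
    qed
  next
    assume "\<forall>z. f z = 0 \<longrightarrow> z = 0"
    then have inj: "inj f" using lin by (simp add: linear_injective_0)
    then have "independent (f ` Basis)"
      by (intro linear_independent_injective_image[OF lin]) (auto simp: independent_Basis inj_on_subset)
    then show "dim (range f) = DIM('a)"
      unfolding range_span using inj by (simp add: dim_eq_card_independent card_image inj_on_subset)
  qed
qed

section \<open>Symmetry of second derivatives\<close>

lemma has_derivative_along_line: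
  fixes g :: "'a::real_normed_vector \<Rightarrow> real"
  assumes "(g has_derivative D) (at (c + r *\<^sub>R w))"
  shows "((\<lambda>r. g (c + r *\<^sub>R w)) has_real_derivative D w) (at r)"
proof -
  have "((\<lambda>r. c + r *\<^sub>R w) has_derivative (\<lambda>t. t *\<^sub>R w)) (at r)"
    by (auto intro!: derivative_eq_intros)
  then have "((\<lambda>r. g (c + r *\<^sub>R w)) has_derivative (\<lambda>t. D (t *\<^sub>R w))) (at r)"
    by (rule has_derivative_compose) (rule assms)
  moreover have "(\<lambda>t. D (t *\<^sub>R w)) = (*) (D w)"
    using linear_scale[OF has_derivative_linear[OF assms]] by (auto simp: mult.commute)
  ultimately show ?thesis by (simp add: has_field_derivative_def)
qed

text \<open>The mixed second difference of \<open>g\<close> over the parallelogram spanned by \<open>t v\<close> and \<open>t w\<close> is symmetric in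
  \<open>v\<close> and \<open>w\<close>. Applying the mean value theorem first in the direction \<open>w\<close> and then in the direction \<open>v\<close>
  writes it as \<open>t\<^sup>2\<close> times a second derivative taken at a nearby point, so continuity gives the limit;
  exchanging \<open>v\<close> and \<open>w\<close> then yields the symmetry of second derivatives.\<close>

lemma mixed_difference_quotient_limit:
  fixes g :: "'a::real_normed_vector \<Rightarrow> real"
  assumes U: "open U" "u \<in> U"
    and G: "\<And>x. x \<in> U \<Longrightarrow> (g has_derivative G x) (at x)"
    and H: "\<And>x. x \<in> U \<Longrightarrow> ((\<lambda>x. G x w) has_derivative H x) (at x)"
    and cont: "continuous_on U (\<lambda>x. H x v)"
  shows "((\<lambda>t. (g (u + t *\<^sub>R v + t *\<^sub>R w) - g (u + t *\<^sub>R v) - g (u + t *\<^sub>R w) + g u) / t\<^sup>2) \<longlongrightarrow> H u v) (at_right 0)"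
proof (rule tendstoI)
  fix e :: real assume e: "e > 0"
  have "isCont (\<lambda>x. H x v) u" using cont U continuous_on_eq_continuous_at by blast
  then obtain d0 where d0: "d0 > 0" "\<And>x. dist x u < d0 \<Longrightarrow> dist (H x v) (H u v) < e"
    using e unfolding continuous_at_eps_delta by metis
  obtain d1 where d1: "d1 > 0" "ball u d1 \<subseteq> U" using U open_contains_ball by blast
  \<comment> \<open>so small that the parallelograms with \<open>t < d\<close> stay inside both balls\<close>
  define d where "d = min d0 d1 / (norm v + norm w + 1)"
  have d: "d > 0" using d0 d1 by (simp add: d_def add_nonneg_pos)
  have near: "dist (u + a *\<^sub>R v + b *\<^sub>R w) u < d0 \<and> u + a *\<^sub>R v + b *\<^sub>R w \<in> U"
    if "0 \<le> a" "a \<le> t" "0 \<le> b" "b \<le> t" "t < d" "0 < t" for a b t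
  proof -
    have "norm (a *\<^sub>R v + b *\<^sub>R w) \<le> t * norm v + t * norm w"
      using that by (intro norm_triangle_mono) (auto intro: mult_right_mono)
    also have "\<dots> \<le> t * (norm v + norm w + 1)" using that by (simp add: algebra_simps)
    also have "\<dots> < d * (norm v + norm w + 1)"
      using that by (intro mult_strict_right_mono) (auto simp: add_nonneg_pos)
    also have "\<dots> = min d0 d1" by (simp add: d_def add_nonneg_eq_0_iff)
    finally have n: "dist (u + a *\<^sub>R v + b *\<^sub>R w) u < min d0 d1" by (simp add: dist_norm add.assoc)
    then have "u + a *\<^sub>R v + b *\<^sub>R w \<in> ball u d1" by (simp add: dist_commute)
    then show ?thesis using n d1 by auto
  qed
  have "dist ((g (u + t *\<^sub>R v + t *\<^sub>R w) - g (u + t *\<^sub>R v) - g (u + t *\<^sub>R w) + g u) / t\<^sup>2) (H u v) < e"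
    if t: "0 < t" "t < d" for t
  proof -
    define \<phi> where "\<phi> = (\<lambda>r. g ((u + t *\<^sub>R v) + r *\<^sub>R w) - g (u + r *\<^sub>R w))"
    have "\<exists>\<xi>>0. \<xi> < t \<and> \<phi> t - \<phi> 0 = (t - 0) * (G ((u + t *\<^sub>R v) + \<xi> *\<^sub>R w) w - G (u + \<xi> *\<^sub>R w) w)"
    proof (rule MVT2[OF t(1)])
      fix r assume r: "0 \<le> r" "r \<le> t"
      show "(\<phi> has_real_derivative (G ((u + t *\<^sub>R v) + r *\<^sub>R w) w - G (u + r *\<^sub>R w) w)) (at r)"
        unfolding \<phi>_def
        using near[of t t r] near[of 0 t r] r t
        by (intro DERIV_diff has_derivative_along_line G) auto
    qed
    then obtain \<xi> where \<xi>: "0 < \<xi>" "\<xi> < t"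
      and 1: "\<phi> t - \<phi> 0 = t * (G ((u + t *\<^sub>R v) + \<xi> *\<^sub>R w) w - G (u + \<xi> *\<^sub>R w) w)" by auto
    have "\<exists>\<eta>>0. \<eta> < t \<and> G ((u + \<xi> *\<^sub>R w) + t *\<^sub>R v) w - G ((u + \<xi> *\<^sub>R w) + 0 *\<^sub>R v) w
        = (t - 0) * H ((u + \<xi> *\<^sub>R w) + \<eta> *\<^sub>R v) v"
    proof (rule MVT2[OF t(1)])
      fix r assume r: "0 \<le> r" "r \<le> t"
      show "((\<lambda>r. G ((u + \<xi> *\<^sub>R w) + r *\<^sub>R v) w) has_real_derivative H ((u + \<xi> *\<^sub>R w) + r *\<^sub>R v) v) (at r)"
        using near[of r t \<xi>] r t \<xi>
        by (intro has_derivative_along_line[where g = "\<lambda>x. G x w"] H) (auto simp: algebra_simps)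
    qed
    then obtain \<eta> where \<eta>: "0 < \<eta>" "\<eta> < t"
      and 2: "G ((u + \<xi> *\<^sub>R w) + t *\<^sub>R v) w - G (u + \<xi> *\<^sub>R w) w = t * H ((u + \<xi> *\<^sub>R w) + \<eta> *\<^sub>R v) v"
      by auto
    have "g (u + t *\<^sub>R v + t *\<^sub>R w) - g (u + t *\<^sub>R v) - g (u + t *\<^sub>R w) + g u = \<phi> t - \<phi> 0"
      by (simp add: \<phi>_def)
    also have "\<dots> = t * (G ((u + \<xi> *\<^sub>R w) + t *\<^sub>R v) w - G (u + \<xi> *\<^sub>R w) w)"
      by (simp add: 1 algebra_simps)
    also have "\<dots> = t\<^sup>2 * H (u + \<eta> *\<^sub>R v + \<xi> *\<^sub>R w) v"
      unfolding 2 by (simp add: power2_eq_square algebra_simps)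
    finally have "(g (u + t *\<^sub>R v + t *\<^sub>R w) - g (u + t *\<^sub>R v) - g (u + t *\<^sub>R w) + g u) / t\<^sup>2
        = H (u + \<eta> *\<^sub>R v + \<xi> *\<^sub>R w) v"
      using t by simp
    then show ?thesis using d0 near[of \<eta> t \<xi>] \<xi> \<eta> t by auto
  qed
  then show "\<forall>\<^sub>F t in at_right 0. dist ((g (u + t *\<^sub>R v + t *\<^sub>R w) - g (u + t *\<^sub>R v) - g (u + t *\<^sub>R w) + g u) / t\<^sup>2) (H u v) < e"
    using d by (auto simp: eventually_at_right_field)
qed

lemma second_derivative_symmetric:
  fixes F :: "'a::real_normed_vector \<Rightarrow> 'b::euclidean_space"
  assumes U: "open U" "u \<in> U" and F: "Ck_on (Suc (Suc 0)) U F"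
  shows "frechet_derivative (\<lambda>x. frechet_derivative F (at x) w) (at u) v
    = frechet_derivative (\<lambda>x. frechet_derivative F (at x) v) (at u) w"
proof (rule euclidean_eqI)
  fix b :: 'b
  let ?G = "\<lambda>x v. frechet_derivative F (at x) v"
  let ?H = "\<lambda>w x v. frechet_derivative (\<lambda>x. ?G x w) (at x) v"
  have 1: "((\<lambda>x. F x \<bullet> b) has_derivative (\<lambda>v. ?G x v \<bullet> b)) (at x)" if "x \<in> U" for x
    using F that by (intro has_derivative_inner_left) (simp add: frechet_derivative_works)
  have 2: "((\<lambda>x. ?G x w \<bullet> b) has_derivative (\<lambda>v. ?H w x v \<bullet> b)) (at x)" if "x \<in> U" for x w
    using F that by (intro has_derivative_inner_left) (simp add: frechet_derivative_works)
  have 3: "continuous_on U (\<lambda>x. ?H w x v \<bullet> b)" for v w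
    using F by (intro continuous_intros) simp
  let ?g = "\<lambda>x. F x \<bullet> b"
  have "((\<lambda>t. (?g (u + t *\<^sub>R v + t *\<^sub>R w) - ?g (u + t *\<^sub>R v) - ?g (u + t *\<^sub>R w) + ?g u) / t\<^sup>2)
      \<longlongrightarrow> ?H w u v \<bullet> b) (at_right 0)"
    by (rule mixed_difference_quotient_limit[OF U 1 2 3])
  moreover have "((\<lambda>t. (?g (u + t *\<^sub>R w + t *\<^sub>R v) - ?g (u + t *\<^sub>R w) - ?g (u + t *\<^sub>R v) + ?g u) / t\<^sup>2)
      \<longlongrightarrow> ?H v u w \<bullet> b) (at_right 0)"
    by (rule mixed_difference_quotient_limit[OF U 1 2 3])
  then have "((\<lambda>t. (?g (u + t *\<^sub>R v + t *\<^sub>R w) - ?g (u + t *\<^sub>R v) - ?g (u + t *\<^sub>R w) + ?g u) / t\<^sup>2)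
      \<longlongrightarrow> ?H v u w \<bullet> b) (at_right 0)"
    by (rule Lim_transform_eventually) (simp add: algebra_simps)
  ultimately show "?H w u v \<bullet> b = ?H v u w \<bullet> b"
    using tendsto_unique trivial_limit_at_right_real by blast
qed

section \<open>Moving orthogonal projections\<close>

lemma closest_point_subspace_eq:
  fixes W :: "'a::euclidean_space set"
  assumes W: "subspace W" and p: "p \<in> W" "\<And>w. w \<in> W \<Longrightarrow> (y - p) \<bullet> w = 0"
  shows "closest_point W y = p"
proof -
  have "dist y p \<le> dist y z" if z: "z \<in> W" for z
  proof -
    have "(y - p) \<bullet> (p - z) = 0" using p z subspace_diff[OF W] by blast
    then have "(norm (y - z))\<^sup>2 = (norm (y - p))\<^sup>2 + (norm (p - z))\<^sup>2"
      using norm_add_Pythagorean[of "y - p" "p - z"] by (simp add: orthogonal_def)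
    then have "(norm (y - p))\<^sup>2 \<le> (norm (y - z))\<^sup>2" by simp
    then show ?thesis unfolding dist_norm by (rule power2_le_imp_le) simp
  qed
  then show ?thesis
    using closest_point_unique[OF subspace_imp_convex[OF W] closed_subspace[OF W] p(1)] by simp
qed

text \<open>The closest point of a subspace is the foot of the perpendicular. This makes the map linear, so
  that the default value of \<open>Blinfun\<close> on unbounded maps never occurs in \<open>orth_proj\<close>.\<close>

lemma orth_proj_char:
  assumes W: "subspace W"
  shows "orth_proj W y \<in> W" "w \<in> W \<Longrightarrow> (y - orth_proj W y) \<bullet> w = 0"
    and "p \<in> W \<Longrightarrow> (\<And>w. w \<in> W \<Longrightarrow> (y - p) \<bullet> w = 0) \<Longrightarrow> orth_proj W y = p"
proof -
  have cp: "closest_point W y \<in> W \<and> (\<forall>w\<in>W. (y - closest_point W y) \<bullet> w = 0)" for y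
  proof -
    have "span W = W" using W by (simp add: span_eq_iff)
    then obtain p z where pz: "p \<in> W" "\<And>w. w \<in> W \<Longrightarrow> z \<bullet> w = 0" "y = p + z"
      using orthogonal_subspace_decomp_exists[of W y] unfolding orthogonal_def by metis
    then have "closest_point W y = p"
      by (intro closest_point_subspace_eq[OF W]) auto
    then show ?thesis using pz by auto
  qed
  have "linear (closest_point W)"
  proof (rule linearI)
    show "closest_point W (x + y) = closest_point W x + closest_point W y" for x y
      using cp[of x] cp[of y]
      by (intro closest_point_subspace_eq[OF W] subspace_add[OF W])
        (auto simp: inner_diff_left inner_add_left)
    show "closest_point W (c *\<^sub>R x) = c *\<^sub>R closest_point W x" for c x
      using cp[of x]
      by (intro closest_point_subspace_eq[OF W] subspace_scale[OF W])
        (auto simp: inner_diff_left)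
  qed
  then have ap: "blinfun_apply (orth_proj W) = closest_point W"
    unfolding orth_proj_def by (intro bounded_linear_Blinfun_apply) (simp add: linear_conv_bounded_linear)
  show "orth_proj W y \<in> W" "w \<in> W \<Longrightarrow> (y - orth_proj W y) \<bullet> w = 0"
    using cp ap by auto
  show "p \<in> W \<Longrightarrow> (\<And>w. w \<in> W \<Longrightarrow> (y - p) \<bullet> w = 0) \<Longrightarrow> orth_proj W y = p"
    using closest_point_subspace_eq[OF W] ap by simp
qed

lemma orth_proj_fixes: "subspace W \<Longrightarrow> y \<in> W \<Longrightarrow> orth_proj W y = y"
  by (rule orth_proj_char(3)) auto

lemma orth_proj_symmetric: 
  assumes W: "subspace W"
  shows "orth_proj W y \<bullet> z = y \<bullet> orth_proj W z"
proof -
  have "(y - orth_proj W y) \<bullet> orth_proj W z = 0" "(z - orth_proj W z) \<bullet> orth_proj W y = 0"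
    using orth_proj_char[OF W] by blast+
  then show ?thesis by (simp add: inner_diff_left inner_diff_right inner_commute)
qed

text \<open>One step of the Gram--Schmidt process, written as a formula for projections. The right-hand
  side is a rational expression in \<open>b\<close> and the previous projection, which is what makes
  differentiability pass from \<open>S\<close> to \<open>insert b S\<close>.\<close>

lemma orth_proj_insert:
  fixes S :: "R6 set"
  assumes b: "b \<notin> span S"
  defines "q \<equiv> b - orth_proj (span S) b"
  shows "orth_proj (span (insert b S)) =
     orth_proj (span S) + (1 / (q \<bullet> q)) *\<^sub>R (blinfun_scaleR_left q o\<^sub>L blinfun_inner_right q)"
    and "q \<bullet> q \<noteq> 0"
proof -
  note P = orth_proj_char[OF subspace_span[of S]]
  have q0: "q \<noteq> 0" using P(1)[of b] b by (auto simp: q_def)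
  then show qq: "q \<bullet> q \<noteq> 0" by simp
  have q_perp: "q \<bullet> w = 0" if "w \<in> span S" for w
    using P(2)[OF that] by (simp add: q_def)
  have qin: "q \<in> span (insert b S)"
    unfolding q_def using P(1)[of b] span_mono[of S "insert b S"]
    by (intro span_diff) (auto intro: span_base)
  show "orth_proj (span (insert b S)) =
     orth_proj (span S) + (1 / (q \<bullet> q)) *\<^sub>R (blinfun_scaleR_left q o\<^sub>L blinfun_inner_right q)"
  proof (rule blinfun_eqI)
    fix y
    let ?p = "orth_proj (span S) y + ((q \<bullet> y) / (q \<bullet> q)) *\<^sub>R q"
    have "orth_proj (span (insert b S)) y = ?p"
    proof (rule orth_proj_char(3)[OF subspace_span])
      show "?p \<in> span (insert b S)"
        using P(1)[of y] span_mono[of S "insert b S"] qin by (intro span_add span_scale) auto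
      fix w assume "w \<in> span (insert b S)"
      then obtain k where k: "w - k *\<^sub>R b \<in> span S" by (auto simp: span_insert)
      have "w - k *\<^sub>R q = (w - k *\<^sub>R b) + k *\<^sub>R orth_proj (span S) b"
        by (simp add: q_def algebra_simps)
      then have z: "w - k *\<^sub>R q \<in> span S" using k P(1) by (metis span_add span_scale)
      have "(y - ?p) \<bullet> q = 0"
        using qq q_perp[OF P(1)[of y]]
        by (subst inner_commute) (simp add: inner_diff_right inner_add_right)
      moreover have "(y - ?p) \<bullet> (w - k *\<^sub>R q) = 0"
        using P(2)[OF z, of y] q_perp[OF z] by (simp add: inner_diff_left inner_add_left)
      ultimately show "(y - ?p) \<bullet> w = 0" by (simp add: inner_diff_right)
    qed
    then show "orth_proj (span (insert b S)) y =
       (orth_proj (span S) + (1 / (q \<bullet> q)) *\<^sub>R (blinfun_scaleR_left q o\<^sub>L blinfun_inner_right q)) y"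
      by (simp add: blinfun.bilinear_simps inner_commute)
  qed
qed

text \<open>The hypothesis on the dimension says that the vectors stay linearly independent near \<open>u\<close>, so no
  denominator of the Gram--Schmidt process vanishes there.\<close>

lemma orth_proj_span_differentiable:
  fixes bs :: "('x::real_normed_vector \<Rightarrow> R6) list"
  assumes "\<And>b. b \<in> set bs \<Longrightarrow> b differentiable (at u)"
    and "\<forall>\<^sub>F x in nhds u. dim ((\<lambda>b. b x) ` set bs) = length bs"
  shows "(\<lambda>x. orth_proj (span ((\<lambda>b. b x) ` set bs))) differentiable (at u)"
  using assms
proof (induction bs)
  case Nil
  then show ?case by simp
next
  case (Cons b bs)
  let ?S = "\<lambda>x. (\<lambda>b. b x) ` set bs"
  have ev: "\<forall>\<^sub>F x in nhds u. dim (?S x) = length bs \<and> b x \<notin> span (?S x)"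
    using Cons.prems(2)
  proof eventually_elim
    case (elim x)
    have "dim (?S x) \<le> card (?S x)" by (rule dim_le_card') simp
    also have "\<dots> \<le> length bs" by (metis card_image_le card_length finite_set le_trans)
    finally show ?case using elim by (auto simp: dim_insert split: if_splits)
  qed
  have P: "(\<lambda>x. orth_proj (span (?S x))) differentiable (at u)"
  proof (rule Cons.IH)
    show "\<forall>\<^sub>F x in nhds u. dim (?S x) = length bs"
      using ev by eventually_elim simp
  qed (use Cons.prems in auto)
  have b: "b differentiable (at u)" using Cons.prems by simp
  define q where "q = (\<lambda>x. b x - orth_proj (span (?S x)) (b x))"
  obtain Pd bd where Pd: "((\<lambda>x. orth_proj (span (?S x))) has_derivative Pd) (at u)"
    and bd: "(b has_derivative bd) (at u)" using P b unfolding differentiable_def by blast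
  obtain qd where qd: "(q has_derivative qd) (at u)"
    unfolding q_def using has_derivative_diff[OF bd blinfun.FDERIV[OF Pd bd]] by blast
  have qq: "q u \<bullet> q u \<noteq> 0"
    using orth_proj_insert(2) eventually_nhds_x_imp_x[OF ev] unfolding q_def by blast
  have 1: "((\<lambda>x. q x \<bullet> q x) has_derivative (\<lambda>h. q u \<bullet> qd h + qd h \<bullet> q u)) (at u)"
    by (rule has_derivative_inner[OF qd qd])
  obtain rd where rd: "((\<lambda>x. 1 / (q x \<bullet> q x)) has_derivative rd) (at u)"
    using has_derivative_divide[OF has_derivative_const 1 qq] by blast
  obtain sd where sd: "((\<lambda>x. blinfun_scaleR_left (q x) o\<^sub>L blinfun_inner_right (q x)) has_derivative sd) (at u)"
    using bounded_bilinear.FDERIV[OF bounded_bilinear_blinfun_compose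
      bounded_linear.has_derivative[OF bounded_linear_blinfun_scaleR_left qd]
      bounded_linear.has_derivative[OF bounded_linear_blinfun_inner_right qd]] by blast
  obtain D where D: "((\<lambda>x. orth_proj (span (?S x)) +
      (1 / (q x \<bullet> q x)) *\<^sub>R (blinfun_scaleR_left (q x) o\<^sub>L blinfun_inner_right (q x))) has_derivative D) (at u)"
    using has_derivative_add[OF Pd has_derivative_scaleR[OF rd sd]] by blast
  have eq: "\<forall>\<^sub>F x in nhds u. orth_proj (span (?S x)) +
      (1 / (q x \<bullet> q x)) *\<^sub>R (blinfun_scaleR_left (q x) o\<^sub>L blinfun_inner_right (q x)) = 
      orth_proj (span ((\<lambda>b. b x) ` set (b # bs)))"
    using ev by eventually_elim (simp add: q_def orth_proj_insert(1))
  have "((\<lambda>x. orth_proj (span ((\<lambda>b. b x) ` set (b # bs)))) has_derivative D) (at u)"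
    using D
  proof (rule has_derivative_transform_eventually)
    show "\<forall>\<^sub>F x in at u. orth_proj (span (?S x)) +
      (1 / (q x \<bullet> q x)) *\<^sub>R (blinfun_scaleR_left (q x) o\<^sub>L blinfun_inner_right (q x)) = 
      orth_proj (span ((\<lambda>b. b x) ` set (b # bs)))"
      using eq by (auto simp: eventually_nhds_conv_at)
  qed (use eventually_nhds_x_imp_x[OF eq] in auto)
  then show ?case by (auto simp: differentiable_def)
qed

lemma orth_proj_range_differentiable:
  fixes f :: "'x::real_normed_vector \<Rightarrow> 'a::euclidean_space \<Rightarrow> R6"
  assumes lin: "\<forall>\<^sub>F x in nhds u. linear (f x) \<and> dim (range (f x)) = DIM('a)"
    and diff: "\<And>i. (\<lambda>x. f x i) differentiable (at u)"
  shows "(\<lambda>x. orth_proj (range (f x))) differentiable (at u)"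
proof -
  obtain L :: "'a list" where L: "set L = Basis" "distinct L"
    using finite_distinct_list[OF finite_Basis, where 'a1 = 'a] by auto
  define bs where "bs = map (\<lambda>i x. f x i) L"
  have len: "length bs = DIM('a)" using L by (simp add: bs_def distinct_card[symmetric])
  have img: "(\<lambda>b. b x) ` set bs = f x ` Basis" for x
    by (simp add: bs_def image_image L)
  have span: "\<forall>\<^sub>F x in nhds u. span ((\<lambda>b. b x) ` set bs) = range (f x) \<and> dim (range (f x)) = DIM('a)"
    using lin by eventually_elim (simp add: img linear_span_image)
  have "(\<lambda>x. orth_proj (span ((\<lambda>b. b x) ` set bs))) differentiable (at u)"
  proof (rule orth_proj_span_differentiable)
    show "b differentiable (at u)" if "b \<in> set bs" for b using that diff by (auto simp: bs_def)
    show "\<forall>\<^sub>F x in nhds u. dim ((\<lambda>b. b x) ` set bs) = length bs"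
      using span by eventually_elim (metis dim_span len)
  qed
  then obtain D where "((\<lambda>x. orth_proj (span ((\<lambda>b. b x) ` set bs))) has_derivative D) (at u)"
    by (auto simp: differentiable_def)
  then have "((\<lambda>x. orth_proj (range (f x))) has_derivative D) (at u)"
  proof (rule has_derivative_transform_eventually)
    show "\<forall>\<^sub>F x in at u. orth_proj (span ((\<lambda>b. b x) ` set bs)) = orth_proj (range (f x))"
      using span by (auto simp: eventually_nhds_conv_at elim: eventually_mono)
  qed (use eventually_nhds_x_imp_x[OF span] in auto)
  then show ?thesis by (auto simp: differentiable_def)
qed

text \<open>The derivative of a moving projection is its second fundamental form: differentiating
  \<open>\<Pi> b = b\<close> for a section \<open>b\<close> shows that \<open>\<Pi>'(v)\<close> maps the value of \<open>b\<close> to the normal component of its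
  derivative. In particular this component depends only on the value of the section.\<close>

lemma projection_derivative_on_section:
  assumes P: "((\<lambda>x. orth_proj (T x)) has_derivative D) (at u)"
    and b: "(b has_derivative d) (at u)"
    and ev: "\<forall>\<^sub>F x in nhds u. subspace (T x) \<and> b x \<in> T x"
  shows "D v (b u) + orth_proj (T u) (d v) = d v"
proof -
  have "((\<lambda>x. orth_proj (T x) (b x)) has_derivative (\<lambda>v. orth_proj (T u) (d v) + D v (b u))) (at u)"
    by (rule blinfun.FDERIV[OF P b])
  moreover have eq: "\<forall>\<^sub>F x in nhds u. b x = orth_proj (T x) (b x)"
    using ev by eventually_elim (simp add: orth_proj_fixes)
  have "((\<lambda>x. orth_proj (T x) (b x)) has_derivative d) (at u)"
    using b
  proof (rule has_derivative_transform_eventually)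
    show "\<forall>\<^sub>F x in at u. b x = orth_proj (T x) (b x)" using eq by (auto simp: eventually_nhds_conv_at)
  qed (use eventually_nhds_x_imp_x[OF eq] in auto)
  ultimately have "(\<lambda>v. orth_proj (T u) (d v) + D v (b u)) = d" by (rule has_derivative_unique)
  from fun_cong[OF this, of v] show ?thesis by (simp add: add.commute)
qed

text \<open>It suffices to test the derivative on the subspace itself: \<open>\<Pi>\<^sup>2 = \<Pi>\<close> makes \<open>\<Pi>'(v)\<close> map the orthogonal
  complement into the subspace, and by symmetry of \<open>\<Pi>'(v)\<close> this part is the transpose of the restriction
  to the subspace.\<close>

lemma projection_derivative_zero:
  assumes P: "((\<lambda>x. orth_proj (T x)) has_derivative D) (at u)"
    and ev: "\<forall>\<^sub>F x in nhds u. subspace (T x)"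
    and zero: "\<And>y. y \<in> T u \<Longrightarrow> D v y = 0"
  shows "D v = 0"
proof (rule blinfun_eqI)
  fix y
  have T: "subspace (T u)" using eventually_nhds_x_imp_x[OF ev] .
  have app: "((\<lambda>x. orth_proj (T x) y) has_derivative (\<lambda>v. D v y)) (at u)" for y
    using blinfun.FDERIV[OF P has_derivative_const[of y]] by (simp add: blinfun.zero_right)
  have sym: "D v y \<bullet> z = y \<bullet> D v z" for y z
  proof -
    have "((\<lambda>x. orth_proj (T x) y \<bullet> z) has_derivative (\<lambda>v. D v y \<bullet> z)) (at u)"
      by (rule has_derivative_inner_left[OF app])
    moreover have eq: "\<forall>\<^sub>F x in nhds u. y \<bullet> orth_proj (T x) z = orth_proj (T x) y \<bullet> z"
      using ev by eventually_elim (simp add: orth_proj_symmetric)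
    have "((\<lambda>x. orth_proj (T x) y \<bullet> z) has_derivative (\<lambda>v. y \<bullet> D v z)) (at u)"
      using has_derivative_inner_right[OF app]
    proof (rule has_derivative_transform_eventually)
      show "\<forall>\<^sub>F x in at u. y \<bullet> orth_proj (T x) z = orth_proj (T x) y \<bullet> z" 
        using eq by (auto simp: eventually_nhds_conv_at)
    qed (use eventually_nhds_x_imp_x[OF eq] in auto)
    ultimately show ?thesis by (metis has_derivative_unique)
  qed
  \<comment> \<open>the tangential component \<open>p\<close> and the normal component \<open>z\<close> of \<open>y\<close>\<close>
  define p where "p = orth_proj (T u) y"
  define z where "z = y - p"
  have p: "p \<in> T u" unfolding p_def by (rule orth_proj_char(1)[OF T])
  have pz: "orth_proj (T u) z = 0"
    unfolding z_def p_def using orth_proj_fixes[OF T orth_proj_char(1)[OF T, of y]]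
    by (simp add: blinfun.diff_right)
  have idem: "((\<lambda>x. orth_proj (T x) (orth_proj (T x) z)) has_derivative (\<lambda>v. orth_proj (T u) (D v z) + D v (orth_proj (T u) z))) (at u)"
    by (rule blinfun.FDERIV[OF P app])
  have eq: "\<forall>\<^sub>F x in nhds u. orth_proj (T x) (orth_proj (T x) z) = orth_proj (T x) z"
    using ev by eventually_elim (simp add: orth_proj_fixes orth_proj_char(1))
  have "((\<lambda>x. orth_proj (T x) z) has_derivative (\<lambda>v. orth_proj (T u) (D v z) + D v (orth_proj (T u) z))) (at u)"
    using idem
  proof (rule has_derivative_transform_eventually)
    show "\<forall>\<^sub>F x in at u. orth_proj (T x) (orth_proj (T x) z) = orth_proj (T x) z"
      using eq by (auto simp: eventually_nhds_conv_at)
  qed (use eventually_nhds_x_imp_x[OF eq] in auto)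
  from has_derivative_unique[OF app this]
  have "D v z = orth_proj (T u) (D v z) + D v (orth_proj (T u) z)" by (rule fun_cong)
  then have "D v z = orth_proj (T u) (D v z)" by (simp add: pz blinfun.zero_right)
  then have "D v z \<in> T u" using orth_proj_char(1)[OF T] by metis
  then have "D v z \<bullet> D v z = 0" using sym[of z "D v z"] zero by simp
  then have "D v z = 0" by simp
  moreover have "D v y = D v p + D v z" by (simp add: z_def blinfun.diff_right)
  ultimately show "D v y = blinfun_apply 0 y" using zero[OF p] by simp
qed

text \<open>Pairing with the component of \<open>D v\<close> orthogonal to \<open>S\<close> gives a function that vanishes near \<open>u\<close>.\<close>

lemma has_derivative_in_subspace:
  fixes f :: "'a::real_normed_vector \<Rightarrow> 'b::euclidean_space"
  assumes S: "subspace S" and ev: "\<forall>\<^sub>F x in nhds u. f x \<in> S" and D: "(f has_derivative D) (at u)"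
  shows "D v \<in> S"
proof -
  obtain y z where yz: "y \<in> span S" "\<And>w. w \<in> span S \<Longrightarrow> orthogonal z w" "D v = y + z"
    using orthogonal_subspace_decomp_exists[of S "D v"] by metis
  have "((\<lambda>x. z \<bullet> f x) has_derivative (\<lambda>v. z \<bullet> D v)) (at u)"
    by (rule has_derivative_inner_right[OF D])
  moreover have zero: "\<forall>\<^sub>F x in nhds u. 0 = z \<bullet> f x"
    using ev by eventually_elim (use yz(2) S in \<open>auto simp: orthogonal_def span_base\<close>)
  have "((\<lambda>x. z \<bullet> f x) has_derivative (\<lambda>v. 0)) (at u)"
    by (rule has_derivative_transform_eventually[OF has_derivative_const])
      (use zero eventually_nhds_x_imp_x[OF zero] in \<open>auto intro: eventually_nhds_conv_at[THEN iffD1, THEN conjunct1]\<close>)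
  ultimately have "z \<bullet> D v = 0"
    using has_derivative_unique by metis
  then have "z \<bullet> z = 0"
    using yz by (simp add: inner_add_right orthogonal_def)
  then show ?thesis using yz S by (metis add.right_neutral inner_eq_zero_iff span_eq_iff)
qed

section \<open>Columns of coordinates\<close>

lemma rmult_rmult: "rmult (rmult X P) Q = rmult X (P ** Q)"
  by (simp add: rmult_def vec_eq_iff matrix_mul_assoc)

lemma rmult_one [simp]: "rmult X (mat 1) = X"
  by (simp add: rmult_def vec_eq_iff)

lemma act_rmult: "act (rmult X P) s = act X (P *v s)"
  by (simp add: rmult_def act_def vec_eq_iff matrix_vector_mul_assoc)

lemma bounded_bilinear_rmult: "bounded_bilinear rmult"
proof -
  have "bilinear rmult"
    by (auto simp: bilinear_def intro!: linearI
        simp: rmult_def matrix_matrix_mult_def vec_eq_iff sum.distrib algebra_simps sum_distrib_left)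
  then show ?thesis by (simp add: bilinear_conv_bounded_bilinear)
qed

lemma bounded_bilinear_act: "bounded_bilinear act"
proof -
  have "bilinear act"
    by (auto simp: bilinear_def intro!: linearI
        simp: act_def matrix_vector_mult_def vec_eq_iff sum.distrib algebra_simps sum_distrib_left)
  then show ?thesis by (simp add: bilinear_conv_bounded_bilinear)
qed

interpretation rmult: bounded_bilinear rmult by (rule bounded_bilinear_rmult)
interpretation act: bounded_bilinear act by (rule bounded_bilinear_act)

lemma act_conv_cols: "act X s = s$1 *\<^sub>R col 1 X + s$2 *\<^sub>R col 2 X"
  by (simp add: col_def act_def vec_eq_iff matrix_vector_mult_def column_def sum_2 algebra_simps)

lemma span_cols: "span (cols X) = range (act X)"
proof -
  have "range (act X) = {y. \<exists>a b. y = a *\<^sub>R col 1 X + b *\<^sub>R col 2 X}" (is "_ = ?R")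
  proof (intro equalityI subsetI)
    fix y assume "y \<in> ?R"
    then obtain a b where "y = a *\<^sub>R col 1 X + b *\<^sub>R col 2 X" by auto
    then have "y = act X (vector [a, b])" by (simp add: act_conv_cols vector_2)
    then show "y \<in> range (act X)" by blast
  qed (auto simp: act_conv_cols)
  also have "\<dots> = span (cols X)"
    by (auto simp: cols_def span_insert span_singleton algebra_simps)
  finally show ?thesis by simp
qed

text \<open>Injectivity of \<open>act X\<close> expresses at once that the two columns are distinct and independent.\<close>

lemma coords_iff:
  "X \<in> coords A \<longleftrightarrow> (\<forall>i. X $ i \<in> A) \<and> (\<forall>s. act X s = 0 \<longrightarrow> s = 0)"
proof -
  have "(col 1 X \<noteq> col 2 X \<and> independent (cols X)) \<longleftrightarrow> (\<forall>s. act X s = 0 \<longrightarrow> s = 0)"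
  proof (cases "col 1 X = col 2 X")
    case True
    have "act X (vector [1, -1]) = 0" "(vector [1, -1] :: real^2) \<noteq> 0"
      using True by (auto simp: act_conv_cols vector_2 vec_eq_iff forall_2)
    then show ?thesis using True by blast
  next
    case False
    have "dependent (cols X) \<longleftrightarrow> (\<exists>u. (\<exists>v\<in>cols X. u v \<noteq> 0) \<and> (\<Sum>v\<in>cols X. u v *\<^sub>R v) = 0)"
      by (rule dependent_finite) (simp add: cols_def)
    also have "\<dots> \<longleftrightarrow> (\<exists>u. (u (col 1 X) \<noteq> 0 \<or> u (col 2 X) \<noteq> 0) \<and> 
        u (col 1 X) *\<^sub>R col 1 X + u (col 2 X) *\<^sub>R col 2 X = 0)"
      using False by (simp add: cols_def)
    also have "\<dots> \<longleftrightarrow> (\<exists>s::real^2. s \<noteq> 0 \<and> act X s = 0)" (is "?L \<longleftrightarrow> ?R")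
    proof
      assume ?L
      then obtain u where u: "u (col 1 X) \<noteq> 0 \<or> u (col 2 X) \<noteq> (0::real)" 
        "u (col 1 X) *\<^sub>R col 1 X + u (col 2 X) *\<^sub>R col 2 X = 0" by blast
      then show ?R
        by (intro exI[of _ "vector [u (col 1 X), u (col 2 X)]"])
          (auto simp: act_conv_cols vector_2 vec_eq_iff forall_2)
    next
      assume ?R
      then obtain s :: "real^2" where "s \<noteq> 0" "act X s = 0" by blast
      then show ?L using False
        by (intro exI[of _ "\<lambda>v. if v = col 1 X then s$1 else s$2"])
          (auto simp: act_conv_cols vec_eq_iff[of s] forall_2)
    qed
    finally show ?thesis using False by auto
  qed
  then show ?thesis by (auto simp: coords_def)
qed

lemma linear_act2: "linear (\<lambda>(s, t). act X s + act Y t)"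
  by (rule linearI) (auto simp: act.add_right act.scaleR_right algebra_simps)

lemma linear_act3: "linear (\<lambda>(s, t, r). act X s + act Y t + act Z r)"
  by (rule linearI) (auto simp: act.add_right act.scaleR_right algebra_simps)

lemma span_cols2: "span (cols X \<union> cols Y) = range (\<lambda>(s, t). act X s + act Y t)"
  by (auto simp: span_Un span_cols)

lemma span_cols3: "span (cols X \<union> cols Y \<union> cols Z) = range (\<lambda>(s, t, r). act X s + act Y t + act Z r)"
proof -
  have "span (cols X \<union> cols Y \<union> cols Z) = {a + b |a b. a \<in> range (\<lambda>(s, t). act X s + act Y t) \<and> b \<in> range (act Z)}"
    by (simp only: span_Un[of "cols X \<union> cols Y"] span_cols span_cols2)
  also have "\<dots> = {y. \<exists>s t r. y = act X s + act Y t + act Z r}"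
    unfolding image_def by (simp; blast)
  also have "\<dots> = range (\<lambda>(s, t, r). act X s + act Y t + act Z r)"
    by (simp add: image_def)
  finally show ?thesis .
qed

lemma not_adjacent_iff:
  "\<not> adjacent X Y \<longleftrightarrow> (\<forall>s t. act X s + act Y t = 0 \<longrightarrow> s = 0 \<and> t = 0)"
proof -
  let ?f = "\<lambda>(s, t). act X s + act Y t"
  have "dim (cols X \<union> cols Y) = dim (range ?f)"
    by (metis dim_span span_cols2)
  moreover have "dim (range ?f) \<le> 4"
    using dim_image_le[OF linear_act2[of X Y], of UNIV] by simp
  ultimately have "\<not> adjacent X Y \<longleftrightarrow> dim (range ?f) = DIM((real^2) \<times> (real^2))"
    by (auto simp: adjacent_def)
  then show ?thesis
    using dim_range_full_iff_inj[OF linear_act2, of X Y] by (simp add: zero_prod_def)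
qed

lemma dim_cols3_iff:
  "dim (cols X \<union> cols Y \<union> cols Z) = 6
     \<longleftrightarrow> (\<forall>s t r. act X s + act Y t + act Z r = 0 \<longrightarrow> s = 0 \<and> t = 0 \<and> r = 0)"
proof -
  let ?f = "\<lambda>(s, t, r). act X s + act Y t + act Z r"
  have "dim (cols X \<union> cols Y \<union> cols Z) = dim (range ?f)"
    by (metis dim_span span_cols3)
  moreover have "DIM((real^2) \<times> (real^2) \<times> (real^2)) = 6" by simp
  ultimately show ?thesis
    using dim_range_full_iff_inj[OF linear_act3, of X Y Z] by (simp add: zero_prod_def)
qed

section \<open>Two-dimensional commutative algebras of matrices\<close>

text \<open>What the complex, double and dual numbers have in common as algebras of matrices. The last axiom
  makes \<open>P \<mapsto> P *v axis 1 1\<close> a linear bijection of the algebra with the plane; hence \<open>X \<mapsto> act X (axis 1 1)\<close>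
  identifies triples over \<open>A\<close> with six-dimensional space, and the span of the two columns of \<open>X\<close> becomes
  the \<open>A\<close>-submodule generated by \<open>X\<close>.\<close>

locale plane_algebra =
  fixes A :: "(real^2^2) set"
  assumes subspace_A: "subspace A"
    and one_in: "mat 1 \<in> A"
    and mult_in: "P \<in> A \<Longrightarrow> Q \<in> A \<Longrightarrow> P ** Q \<in> A"
    and mult_comm: "P \<in> A \<Longrightarrow> Q \<in> A \<Longrightarrow> P ** Q = Q ** P"
    and unique_first_column: "\<exists>!P. P \<in> A \<and> P *v axis 1 1 = s"

lemma mat2_eq_iff: "(P::real^2^2) = Q \<longleftrightarrow> P$1$1 = Q$1$1 \<and> P$1$2 = Q$1$2 \<and> P$2$1 = Q$2$1 \<and> P$2$2 = Q$2$2"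
  by (auto simp: vec_eq_iff forall_2)

lemma mem_alg_C: "P \<in> alg_C \<longleftrightarrow> P$1$1 = P$2$2 \<and> P$1$2 = - P$2$1"
proof -
  have "P = vector [vector [P$1$1, - P$2$1], vector [P$2$1, P$1$1]]" if "P$1$1 = P$2$2 \<and> P$1$2 = - P$2$1"
    using that by (simp add: mat2_eq_iff vector_2)
  then show ?thesis unfolding alg_C_def by (auto simp: vector_2)
qed

lemma mem_alg_C1: "P \<in> alg_C1 \<longleftrightarrow> P$1$1 = P$2$2 \<and> P$1$2 = P$2$1"
proof -
  have "P = vector [vector [P$1$1, P$2$1], vector [P$2$1, P$1$1]]" if "P$1$1 = P$2$2 \<and> P$1$2 = P$2$1"
    using that by (simp add: mat2_eq_iff vector_2)
  then show ?thesis unfolding alg_C1_def by (auto simp: vector_2)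
qed

lemma mem_alg_C0: "P \<in> alg_C0 \<longleftrightarrow> P$1$1 = P$2$2 \<and> P$1$2 = 0"
proof -
  have "P = vector [vector [P$1$1, 0], vector [P$2$1, P$1$1]]" if "P$1$1 = P$2$2 \<and> P$1$2 = 0"
    using that by (simp add: mat2_eq_iff vector_2)
  then show ?thesis unfolding alg_C0_def by (auto simp: vector_2)
qed

lemma plane_algebra_alg:
  assumes "A = alg_C \<or> A = alg_C1 \<or> A = alg_C0"
  shows "plane_algebra A"
proof -
  \<comment> \<open>All three are the matrices with equal diagonal entries whose upper right entry is \<open>c\<close> times the
    lower left one, for \<open>c = -1, 1, 0\<close>.\<close>
  obtain c :: real where mem: "\<And>P. P \<in> A \<longleftrightarrow> P$1$1 = P$2$2 \<and> P$1$2 = c * P$2$1"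
    using assms mem_alg_C mem_alg_C1 mem_alg_C0
    by (metis mult_minus1 mult_1 mult_zero_left)
  note entries = matrix_matrix_mult_def matrix_vector_mult_def axis_def vec_eq_iff forall_2 sum_2
  show ?thesis
  proof
    show "subspace A" by (auto simp: subspace_def mem algebra_simps)
    show "mat 1 \<in> A" by (simp add: mem mat_def)
    show "P ** Q \<in> A" if "P \<in> A" "Q \<in> A" for P Q
      using that by (simp add: mem entries algebra_simps)
    show "P ** Q = Q ** P" if "P \<in> A" "Q \<in> A" for P Q
      using that by (simp add: mem entries algebra_simps)
    show "\<exists>!P. P \<in> A \<and> P *v axis 1 1 = s" for s
    proof (rule ex1I[of _ "vector [vector [s$1, c * s$2], vector [s$2, s$1]]"])
      show "P = vector [vector [s$1, c * s$2], vector [s$2, s$1]]"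
        if "P \<in> A \<and> P *v axis 1 1 = s" for P
        using that by (auto simp: mem entries vector_2)
    qed (auto simp: mem entries vector_2)
  qed
qed

lemma inverse_matrix_cancel: 
  fixes P Q :: "real^'n^'n"
  assumes "P ** Q = mat 1"
  shows "Q *v (P *v s) = s" "P *v (Q *v s) = s"
  using assms matrix_left_right_inverse[of P Q] by (simp_all add: matrix_vector_mul_assoc)

lemma matrix_mult_zero_right: "(P::real^'n^'m) ** (0::real^'k^'n) = 0"
  by (simp add: matrix_matrix_mult_def vec_eq_iff)

context plane_algebra
begin

text \<open>The element of \<open>A\<close> with first column \<open>s\<close>: it carries the multiplication of \<open>A\<close> over to the plane, so
  that \<open>of_column s *v t\<close> is a commutative product of vectors.\<close>

definition of_column :: "real^2 \<Rightarrow> real^2^2" where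
  "of_column s = (THE P. P \<in> A \<and> P *v axis 1 1 = s)"

lemma of_column_in [simp]: "of_column s \<in> A" and of_column_axis [simp]: "of_column s *v axis 1 1 = s"
  using theI'[OF unique_first_column[of s]] by (auto simp: of_column_def)

lemma eq_if_first_column_eq:
  "P \<in> A \<Longrightarrow> Q \<in> A \<Longrightarrow> P *v axis 1 1 = Q *v axis 1 1 \<Longrightarrow> P = Q"
  using unique_first_column by blast

lemma of_column_column: "P \<in> A \<Longrightarrow> of_column (P *v axis 1 1) = P"
  by (rule eq_if_first_column_eq) auto

lemma of_column_comm: "of_column s *v t = of_column t *v s"
proof -
  have "of_column s *v t = (of_column s ** of_column t) *v axis 1 1" 
    by (simp add: matrix_vector_mul_assoc[symmetric])
  also have "\<dots> = (of_column t ** of_column s) *v axis 1 1" by (simp add: mult_comm)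
  also have "\<dots> = of_column t *v s" by (simp add: matrix_vector_mul_assoc[symmetric])
  finally show ?thesis .
qed

lemmas add_in = subspace_add[OF subspace_A] and scale_in = subspace_scale[OF subspace_A]
  and zero_in = subspace_0[OF subspace_A] and diff_in = subspace_diff[OF subspace_A]

lemma linear_of_column: "linear of_column"
proof (rule linearI)
  show "of_column (s + t) = of_column s + of_column t" for s t
    by (rule eq_if_first_column_eq) (auto simp: add_in matrix_vector_mult_add_rdistrib)
  show "of_column (c *\<^sub>R s) = c *\<^sub>R of_column s" for c s
    by (rule eq_if_first_column_eq) (auto simp: scale_in scaleR_matrix_vector_assoc[symmetric])
qed

text \<open>Positions \<open>s\<close> on a generator for which \<open>s\<close>, read as an element of \<open>A\<close>, is invertible. Over the complex
  numbers these are all \<open>s \<noteq> 0\<close>; over the double and dual numbers each generator has two, respectively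
  one, exceptional points, which turn out not to be regular points of the ruled submanifold.\<close>

definition is_unit_vec :: "real^2 \<Rightarrow> bool" where
  "is_unit_vec s \<longleftrightarrow> (\<exists>P\<in>A. of_column s ** P = mat 1)"

text \<open>In finite dimension multiplication by a non-zero-divisor is injective, hence surjective, and so
  attains \<open>1\<close>.\<close>

lemma invertible_if_injective:
  assumes P: "P \<in> A" and inj: "\<And>Q. Q \<in> A \<Longrightarrow> P ** Q = 0 \<Longrightarrow> Q = 0"
  shows "\<exists>Q\<in>A. P ** Q = mat 1"
proof -
  have "t = 0" if "P *v t = 0" for t
  proof -
    have "P ** of_column t = 0"
      using P that mult_in
      by (intro eq_if_first_column_eq) (auto simp: zero_in matrix_vector_mul_assoc[symmetric])
    then have "of_column t = 0" using inj by simp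
    then show ?thesis by (metis of_column_axis matrix_vector_mult_0)
  qed
  then have "inj ((*v) P)" by (simp add: linear_injective_0)
  then have "surj ((*v) P)" by (simp add: linear_injective_imp_surjective)
  then obtain t where "P *v t = axis 1 1" by (metis surjD)
  then have "P ** of_column t = mat 1"
    using P mult_in one_in by (intro eq_if_first_column_eq) (auto simp: matrix_vector_mul_assoc[symmetric])
  then show ?thesis by auto
qed

lemma not_zero_divisor_iff: "not_zero_divisor A P \<longleftrightarrow> P \<in> A \<and> (\<exists>Q\<in>A. P ** Q = mat 1)"
proof
  assume "not_zero_divisor A P"
  then show "P \<in> A \<and> (\<exists>Q\<in>A. P ** Q = mat 1)"
    unfolding not_zero_divisor_def using invertible_if_injective by blast
next
  assume "P \<in> A \<and> (\<exists>Q\<in>A. P ** Q = mat 1)"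
  then obtain Q where Q: "P \<in> A" "Q \<in> A" "P ** Q = mat 1" by auto
  then have "Q ** P = mat 1" by (simp add: mult_comm)
  then have "R = 0" if "P ** R = 0" for R
    using that by (metis matrix_mul_assoc matrix_mul_lid matrix_mult_zero_right)
  then show "not_zero_divisor A P" using Q by (auto simp: not_zero_divisor_def)
qed

lemma is_unit_vec_iff: "is_unit_vec s \<longleftrightarrow> not_zero_divisor A (of_column s)"
  by (simp add: is_unit_vec_def not_zero_divisor_iff)

lemma is_unit_vec_nonzero: "is_unit_vec s \<Longrightarrow> s \<noteq> 0"
  unfolding is_unit_vec_def by (metis of_column_axis linear_0[OF linear_of_column] matrix_vector_mul_assoc
      matrix_vector_mul_lid matrix_vector_mult_0 axis_eq_0_iff zero_neq_one)

lemma nonunit_annihilated: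
  assumes "\<not> is_unit_vec s"
  obtains r where "r \<noteq> 0" "of_column s *v r = 0"
proof -
  obtain Q where Q: "Q \<in> A" "of_column s ** Q = 0" "Q \<noteq> 0"
    using assms by (auto simp: is_unit_vec_iff not_zero_divisor_def)
  have "of_column s *v (Q *v axis 1 1) = 0"
    by (simp add: matrix_vector_mul_assoc Q)
  moreover have "Q *v axis 1 1 \<noteq> 0"
    using Q eq_if_first_column_eq[of Q 0] zero_in by auto
  ultimately show thesis using that by blast
qed

lemma is_unit_axis: "is_unit_vec (axis 1 1)"
proof -
  have "of_column (axis 1 1) = mat 1"
    by (rule eq_if_first_column_eq) (auto simp: one_in)
  then show ?thesis using one_in by (auto simp: is_unit_vec_def)
qed

lemma unit_mult_unit:
  assumes "not_zero_divisor A P" "is_unit_vec s"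
  shows "is_unit_vec (P *v s)"
proof -
  obtain Q R where Q: "P \<in> A" "Q \<in> A" "P ** Q = mat 1" and R: "R \<in> A" "of_column s ** R = mat 1"
    using assms by (auto simp: is_unit_vec_def not_zero_divisor_iff)
  have "of_column (P *v s) = P ** of_column s"
    using Q mult_in by (intro eq_if_first_column_eq) (auto simp: matrix_vector_mul_assoc[symmetric])
  also have "\<dots> ** (R ** Q) = P ** (of_column s ** R) ** Q" by (simp add: matrix_mul_assoc)
  also have "\<dots> = mat 1" using Q R by simp
  finally show ?thesis unfolding is_unit_vec_def using Q R mult_in by blast
qed

lemma unit_generates:
  assumes "is_unit_vec s"
  obtains P where "P \<in> A" "P *v s = t"
proof -
  obtain Q where Q: "Q \<in> A" "of_column s ** Q = mat 1" using assms by (auto simp: is_unit_vec_def)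
  have "(of_column t ** Q) *v s = t"
    using Q by (metis of_column_axis of_column_in matrix_vector_mul_assoc matrix_vector_mul_lid mult_comm)
  then show thesis using that Q mult_in of_column_in by blast
qed

lemma eq_if_unit_eq:
  assumes "is_unit_vec s" "P \<in> A" "Q \<in> A" "P *v s = Q *v s"
  shows "P = Q"
proof -
  obtain R where R: "R \<in> A" "of_column s ** R = mat 1" using assms by (auto simp: is_unit_vec_def)
  have "P *v s = (P ** of_column s) *v axis 1 1" "Q *v s = (Q ** of_column s) *v axis 1 1" 
    by (simp_all add: matrix_vector_mul_assoc[symmetric])
  then have "P ** of_column s = Q ** of_column s"
    using assms mult_in by (intro eq_if_first_column_eq) auto
  then have "P ** (of_column s ** R) = Q ** (of_column s ** R)" by (simp add: matrix_mul_assoc)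
  then show ?thesis using R by simp
qed

lemma open_units: "open {s. is_unit_vec s}"
proof -
  have "is_unit_vec s \<longleftrightarrow> det (of_column s) \<noteq> 0" for s
  proof
    assume "is_unit_vec s"
    then show "det (of_column s) \<noteq> 0"
      unfolding is_unit_vec_def by (metis det_I det_mul mult_zero_left zero_neq_one)
  next
    assume d: "det (of_column s) \<noteq> 0"
    show "is_unit_vec s"
    proof (rule ccontr)
      assume "\<not> is_unit_vec s"
      then obtain r where "r \<noteq> 0" "of_column s *v r = 0" by (rule nonunit_annihilated)
      then show False using d
        by (metis invertible_det_nz matrix_left_invertible_ker invertible_def)
    qed
  qed
  then have "{s. is_unit_vec s} = (\<lambda>s. det (of_column s)) -` (- {0})" by auto
  moreover have "continuous_on UNIV (\<lambda>s. det (of_column s))"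
    using linear_continuous_on[OF linear_of_column[unfolded linear_conv_bounded_linear], of UNIV]
    unfolding det_2 by (intro continuous_intros)
  ultimately show ?thesis
    by (auto intro!: open_vimage)
qed

text \<open>The hypothesis says that no nonzero element annihilates both \<open>P\<close> and \<open>Q\<close>; the conclusion says that
  the column \<open>(P, Q)\<close> can be completed to an invertible two by two matrix over \<open>A\<close>. Otherwise the
  ideal generated by \<open>P\<close> and \<open>Q\<close> would consist of zero divisors; being a proper subspace of the plane
  it would be spanned by a single \<open>r\<close>, and an annihilator of \<open>r\<close> would annihilate both \<open>P\<close> and \<open>Q\<close>.\<close>

lemma unimodular_combination:
  assumes P: "P \<in> A" and Q: "Q \<in> A"
    and unimod: "\<And>q. P *v q = 0 \<Longrightarrow> Q *v q = 0 \<Longrightarrow> q = 0"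
  shows "\<exists>a\<in>A. \<exists>b\<in>A. not_zero_divisor A (P ** b - Q ** a)"
proof (rule ccontr)
  assume "\<not> ?thesis"
  then have sing: "\<not> not_zero_divisor A (P ** b - Q ** a)" if "a \<in> A" "b \<in> A" for a b
    using that by blast
  \<comment> \<open>the ideal generated by \<open>P\<close> and \<open>Q\<close>, transferred to the plane\<close>
  define J where "J = range (\<lambda>(s, t). P *v t - Q *v s)"
  have lin: "linear (\<lambda>(s, t). P *v t - Q *v s)"
    by (rule linearI) (auto simp: matrix_vector_right_distrib matrix_vector_mult_scaleR algebra_simps)
  have J: "subspace J" unfolding J_def by (rule linear_subspace_image[OF lin subspace_UNIV])
  have nonunit: "\<not> is_unit_vec r" if rJ: "r \<in> J" for r
  proof -
    obtain s t where r: "r = P *v t - Q *v s" using rJ by (auto simp: J_def)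
    have "of_column r = P ** of_column t - Q ** of_column s"
      using P Q mult_in by (intro eq_if_first_column_eq)
        (auto simp: r diff_in matrix_vector_mult_diff_rdistrib matrix_vector_mul_assoc[symmetric])
    then show ?thesis using sing by (simp add: is_unit_vec_iff)
  qed
  have PJ: "P *v t \<in> J" and QJ: "Q *v t \<in> J" for t
  proof -
    have "P *v t = (\<lambda>(s, t). P *v t - Q *v s) (0, t)" "Q *v t = (\<lambda>(s, t). P *v t - Q *v s) (- t, 0)"
      by (simp_all add: linear_neg[OF matrix_vector_mul_linear])
    then show "P *v t \<in> J" "Q *v t \<in> J" unfolding J_def by (metis rangeI)+
  qed
  show False
  proof (cases "J = {0}")
    case True
    then have "axis 1 1 = (0::real^2)" using unimod PJ QJ by blast
    then show False by simp
  next
    case False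
    then obtain r where r: "r \<in> J" "r \<noteq> 0" using subspace_0[OF J] by blast
    obtain q where q: "q \<noteq> 0" "of_column r *v q = 0" using nonunit_annihilated[OF nonunit[OF r(1)]] by blast
    have "span {r} = J"
    proof (rule subspace_dim_equal)
      have "J \<noteq> UNIV" using nonunit is_unit_axis by auto
      then have "dim J \<noteq> 2"
        using dim_eq_full[of J] J by (simp add: span_eq_iff[THEN iffD2])
      moreover have "dim J \<le> 2" using dim_subset_UNIV[of J] by simp
      moreover have "dim (span {r}) = 1" using r by (simp add: dim_insert)
      ultimately show "dim J \<le> dim (span {r})" by simp
    qed (use J r in \<open>auto simp: span_minimal\<close>)
    have kill: "R *v q = 0" if R: "R \<in> A" "R *v axis 1 1 \<in> J" for R
    proof -
      obtain c where "R *v axis 1 1 = c *\<^sub>R r"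
        using R \<open>span {r} = J\<close> by (auto simp: span_singleton)
      then have "R = c *\<^sub>R of_column r"
        using R by (intro eq_if_first_column_eq) (auto simp: scale_in scaleR_matrix_vector_assoc[symmetric])
      then show ?thesis using q by (simp add: scaleR_matrix_vector_assoc[symmetric])
    qed
    show False using unimod[OF kill[OF P PJ] kill[OF Q QJ]] q by blast
  qed
qed

section \<open>Points and generators\<close>

definition triples :: "coord set" where "triples = {X. \<forall>i. X $ i \<in> A}"

lemma subspace_triples: "subspace triples"
  by (auto simp: subspace_def triples_def zero_in add_in scale_in)

lemmas add_triples = subspace_add[OF subspace_triples] and scale_triples = subspace_scale[OF subspace_triples]

lemma rmult_triples [intro]: "X \<in> triples \<Longrightarrow> P \<in> A \<Longrightarrow> rmult X P \<in> triples"
  by (simp add: triples_def rmult_def mult_in)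

text \<open>For a unit \<open>s\<close> every vector is \<open>P *v s\<close> for exactly one \<open>P \<in> A\<close>, so each block of \<open>act X s\<close>
  determines the corresponding block of \<open>X\<close>.\<close>

lemma act_unit_inject:
  assumes "is_unit_vec s" "X \<in> triples" "Y \<in> triples" "act X s = act Y s"
  shows "X = Y"
  using assms eq_if_unit_eq by (auto simp: act_def triples_def vec_eq_iff[of _ "_::(real^2)^3"] vec_eq_iff[of X Y])

lemma coords_triples: "X \<in> coords A \<Longrightarrow> X \<in> triples"
  by (simp add: coords_iff triples_def)

lemma coords_act: "X \<in> coords A \<Longrightarrow> act X s = 0 \<Longrightarrow> s = 0"
  by (simp add: coords_iff)

lemma coordsI: "X \<in> triples \<Longrightarrow> (\<And>s. act X s = 0 \<Longrightarrow> s = 0) \<Longrightarrow> X \<in> coords A"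
  by (simp add: coords_iff triples_def)

lemma rmult_coords:
  assumes "X \<in> coords A" "not_zero_divisor A P"
  shows "rmult X P \<in> coords A"
proof (rule coordsI)
  show "rmult X P \<in> triples" using assms by (auto simp: coords_triples not_zero_divisor_def)
  fix s assume "act (rmult X P) s = 0"
  then have "P *v s = 0" using assms coords_act by (simp add: act_rmult)
  moreover obtain Q where "P ** Q = mat 1" using assms by (auto simp: not_zero_divisor_iff)
  ultimately show "s = 0" by (metis inverse_matrix_cancel(1) matrix_vector_mult_0_right)
qed

lemma not_zero_divisor_mult: "not_zero_divisor A P \<Longrightarrow> not_zero_divisor A Q \<Longrightarrow> not_zero_divisor A (P ** Q)"
  unfolding not_zero_divisor_def by (metis matrix_mul_assoc mult_in)

lemma inverse_obtain:
  assumes "not_zero_divisor A P"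
  obtains Q where "not_zero_divisor A Q" "P ** Q = mat 1" "Q ** P = mat 1"
  using assms unfolding not_zero_divisor_iff by (metis mult_comm)

lemma mem_point_self: "X \<in> point A X"
  unfolding point_def not_zero_divisor_iff using one_in
  by (metis (mono_tags, lifting) matrix_mul_lid mem_Collect_eq rmult_one)

lemma point_rmult:
  assumes "not_zero_divisor A P"
  shows "point A (rmult X P) = point A X"
proof -
  obtain Q where Q: "not_zero_divisor A Q" "P ** Q = mat 1" using assms by (rule inverse_obtain)
  show ?thesis
    unfolding point_def
  proof (intro equalityI subsetI; clarsimp simp: rmult_rmult)
    fix R assume "not_zero_divisor A R"
    then show "\<exists>Pa. rmult X (P ** R) = rmult X Pa \<and> not_zero_divisor A Pa"
      using assms not_zero_divisor_mult by blast
  next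
    fix R assume "not_zero_divisor A R"
    moreover have "R = P ** (Q ** R)" by (simp add: matrix_mul_assoc Q)
    ultimately show "\<exists>Pa. rmult X R = rmult X (P ** Pa) \<and> not_zero_divisor A Pa"
      using Q not_zero_divisor_mult by metis
  qed
qed

lemma point_eq_iff: "point A X = point A Y \<longleftrightarrow> (\<exists>P. not_zero_divisor A P \<and> X = rmult Y P)"
  using mem_point_self[of X] point_rmult by (fastforce simp: point_def)

end

lemma rp_eq_iff: "x \<noteq> 0 \<Longrightarrow> rp x = rp y \<longleftrightarrow> (\<exists>c. c \<noteq> 0 \<and> x = c *\<^sub>R y)"
proof -
  assume x: "x \<noteq> 0"
  have "rp x = rp y" if "c \<noteq> 0" "x = c *\<^sub>R y" for c
    using that span_image_scale[of "{y}" "\<lambda>_. c"] by (simp add: rp_def)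
  moreover have "\<exists>c. c \<noteq> 0 \<and> x = c *\<^sub>R y" if "rp x = rp y"
  proof -
    have "x \<in> span {y}" using that by (metis rp_def span_base singletonI)
    then show ?thesis using x by (auto simp: span_singleton)
  qed
  ultimately show ?thesis by blast
qed

context plane_algebra
begin

text \<open>Different generators may meet, but only at exceptional points. If \<open>act Y t\<close> is a multiple of
  \<open>act X s\<close> and \<open>s\<close> is a unit, write \<open>t = P s\<close>; then \<open>Y P\<close> is a multiple of \<open>X\<close>, and \<open>P\<close> cannot be a zero
  divisor since \<open>X\<close> is not annihilated by any nonzero element.\<close>

lemma unit_position_determines_point:
  assumes X: "X \<in> coords A" and Y: "Y \<in> coords A" and s: "is_unit_vec s" and t: "t \<noteq> 0"
    and eq: "rp (act X s) = rp (act Y t)"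
  shows "is_unit_vec t" "point A X = point A Y"
proof -
  have t0: "act Y t \<noteq> 0" using Y t coords_act by blast
  then obtain c where c: "c \<noteq> 0" "act Y t = c *\<^sub>R act X s"
    using rp_eq_iff eq by metis
  obtain P where P: "P \<in> A" "P *v s = t" using s by (rule unit_generates)
  have "act (rmult Y P) s = act (c *\<^sub>R X) s"
    using c P by (simp add: act_rmult act.scaleR_left)
  then have YP: "rmult Y P = c *\<^sub>R X"
    using s X Y P by (intro act_unit_inject[of s]) (auto intro: scale_triples coords_triples)
  have unit: "not_zero_divisor A P"
    unfolding not_zero_divisor_def
  proof (intro conjI ballI impI)
    fix Q assume Q: "Q \<in> A" "P ** Q = 0"
    then have "rmult (rmult Y P) Q = 0" by (simp add: rmult_rmult rmult.zero_right)
    then have "rmult X Q = 0" using c by (simp add: YP rmult.scaleR_left)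
    then have "act X (Q *v axis 1 1) = 0" by (metis act_rmult act.zero_left)
    then have "Q *v axis 1 1 = 0" using X coords_act by blast
    then show "Q = 0" using Q zero_in by (intro eq_if_first_column_eq) auto
  qed (use P in auto)
  then show "is_unit_vec t" using P s unit_mult_unit by blast
  have cunit: "not_zero_divisor A (c *\<^sub>R mat 1)"
    using c one_in scale_in by (auto simp: not_zero_divisor_def scalar_matrix_assoc[symmetric]
        scaleR_matrix_vector_assoc simp flip: scalar_mult_eq_scaleR)
  have "rmult X (c *\<^sub>R mat 1) = rmult Y P"
    by (simp add: YP rmult.scaleR_right)
  then show "point A X = point A Y" by (metis point_rmult unit cunit)
qed

end

section \<open>Tangent spaces of an A-smooth line\<close>

lemma local_param_differentiable:
  assumes "local_param A \<gamma> U F" "u \<in> U"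
  shows "(F has_derivative frechet_derivative F (at u)) (at u)"
proof -
  have "Ck_on (Suc 0) U F" using assms by (simp add: local_param_def smooth_on_def)
  then show ?thesis using assms by (simp add: frechet_derivative_works)
qed

lemma frechet_derivative_linear:
  assumes "local_param A \<gamma> U F" "u \<in> U"
  shows "linear (frechet_derivative F (at u))"
  by (rule has_derivative_linear[OF local_param_differentiable[OF assms]])

lemma velocity_derivative:
  assumes "local_param A \<gamma> U F" "u \<in> U"
  shows "((\<lambda>x. frechet_derivative F (at x) w) has_derivative
    frechet_derivative (\<lambda>x. frechet_derivative F (at x) w) (at u)) (at u)"
proof -
  have "Ck_on (Suc (Suc 0)) U F" using assms unfolding local_param_def smooth_on_def by blast
  then show ?thesis using assms by (simp add: frechet_derivative_works)
qed

lemma eventually_in_domain: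
  assumes "local_param A \<gamma> U F" "u \<in> U"
  shows "\<forall>\<^sub>F x in nhds u. x \<in> U"
  using assms eventually_nhds by (auto simp: local_param_def)

lemma local_param_cone:
  assumes "local_param A \<gamma> U F" "u \<in> U"
  shows "F u \<in> cone A \<gamma>"
proof -
  have "(point A \<circ> F) ` U \<subseteq> \<gamma>"
    using assms openin_subset[of "subtopology (AP2_topology A) \<gamma>" "(point A \<circ> F) ` U"]
    by (auto simp: local_param_def topspace_subtopology)
  then show ?thesis using assms by (auto simp: cone_def local_param_def)
qed

lemma local_param_coords: "local_param A \<gamma> U F \<Longrightarrow> u \<in> U \<Longrightarrow> F u \<in> coords A"
  by (auto simp: local_param_def)

context plane_algebra
begin

text \<open>The \<open>A\<close>-module underlying the straight line through \<open>X\<close> and \<open>Y\<close>.\<close>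

definition pair_module :: "coord \<Rightarrow> coord \<Rightarrow> coord set" where
  "pair_module X Y = {rmult X P + rmult Y Q | P Q. P \<in> A \<and> Q \<in> A}"

lemma linear_pair_module: "linear (\<lambda>(s, t). rmult X (of_column s) + rmult Y (of_column t))"
  by (rule linearI) (auto simp: linear_add[OF linear_of_column] linear_scale[OF linear_of_column]
    rmult.add_right rmult.scaleR_right algebra_simps)

lemma pair_module_range: "pair_module X Y = range (\<lambda>(s, t). rmult X (of_column s) + rmult Y (of_column t))"
proof -
  have "rmult X P + rmult Y Q \<in> range (\<lambda>(s, t). rmult X (of_column s) + rmult Y (of_column t))"
    if "P \<in> A" "Q \<in> A" for P Q
    using that by (intro image_eqI[of _ _ "(P *v axis 1 1, Q *v axis 1 1)"]) (auto simp: of_column_column)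
  then show ?thesis by (auto simp: pair_module_def intro!: of_column_in)
qed

lemma subspace_pair_module: "subspace (pair_module X Y)"
  unfolding pair_module_range by (rule linear_subspace_image[OF linear_pair_module subspace_UNIV])

lemma pair_module_mult: "W \<in> pair_module X Y \<Longrightarrow> Q \<in> A \<Longrightarrow> rmult W Q \<in> pair_module X Y"
  unfolding pair_module_def by (auto simp: rmult.add_left rmult_rmult) (metis mult_in)

lemma dim_pair_module_le: "dim (pair_module X Y) \<le> 4"
  unfolding pair_module_range using dim_image_le[OF linear_pair_module[of X Y], of UNIV] by simp

lemma dim_pair_module:
  assumes "\<not> adjacent X Y"
  shows "dim (pair_module X Y) = 4"
proof -
  have "s = 0 \<and> t = 0" if "rmult X (of_column s) + rmult Y (of_column t) = 0" for s t
  proof -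
    have "act (rmult X (of_column s) + rmult Y (of_column t)) (axis 1 1) = 0" using that by (simp add: act.zero_left)
    then have "act X s + act Y t = 0" by (simp add: act.add_left act_rmult)
    then show ?thesis using assms by (simp add: not_adjacent_iff)
  qed
  then show ?thesis
    unfolding pair_module_range using dim_range_full_iff_inj[OF linear_pair_module, of X Y] by (auto simp: zero_prod_def)
qed

lemma cone_straight_line:
  assumes "X \<in> cone A (straight_line A X0 Y0)"
  shows "X \<in> pair_module X0 Y0"
proof -
  obtain Z where Z: "Z \<in> pair_module X0 Y0" "point A X = point A Z"
    using assms by (auto simp: cone_def straight_line_def pair_module_def)
  then show ?thesis using pair_module_mult by (auto simp: point_eq_iff not_zero_divisor_def)
qed

text \<open>All representatives of points of a straight line lie in one fixed linear space, hence so do the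
  velocities.\<close>

lemma tangent_space_straight_line:
  "tangent_space A (straight_line A X0 Y0) X \<subseteq> pair_module X0 Y0"
proof
  fix w assume "w \<in> tangent_space A (straight_line A X0 Y0) X"
  then obtain c where c: "\<forall>\<^sub>F t in nhds 0. c t \<in> cone A (straight_line A X0 Y0)"
    "(c has_vector_derivative w) (at 0)"
    by (auto simp: tangent_space_def)
  have "\<forall>\<^sub>F t in nhds 0. c t \<in> pair_module X0 Y0"
    using c(1) by eventually_elim (rule cone_straight_line)
  then have "1 *\<^sub>R w \<in> pair_module X0 Y0"
    by (rule has_derivative_in_subspace[OF subspace_pair_module _ c(2)[unfolded has_vector_derivative_def]])
  then show "w \<in> pair_module X0 Y0" by simp
qed

lemma tangent_space_rmult:
  assumes P: "not_zero_divisor A P" and w: "w \<in> tangent_space A \<gamma> X"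
  shows "rmult w P \<in> tangent_space A \<gamma> (rmult X P)"
proof -
  obtain c where c: "c 0 = X" "\<forall>\<^sub>F t in nhds 0. c t \<in> cone A \<gamma>" "(c has_vector_derivative w) (at 0)"
    using w by (auto simp: tangent_space_def)
  have "((\<lambda>t. rmult (c t) P) has_vector_derivative rmult w P) (at 0)"
    by (rule bounded_linear.has_vector_derivative[OF rmult.bounded_linear_left c(3)])
  moreover have "\<forall>\<^sub>F t in nhds 0. rmult (c t) P \<in> cone A \<gamma>"
    using c(2) by eventually_elim (auto simp: cone_def rmult_coords P point_rmult)
  ultimately show ?thesis unfolding tangent_space_def using c(1)
    by (intro CollectI exI[of _ "\<lambda>t. rmult (c t) P"]) simp
qed

text \<open>The curve \<open>t \<mapsto> F (u + t v) (1 + t P)\<close> stays over \<open>\<gamma>\<close> as long as \<open>1 + t P\<close> is invertible, and has this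
  velocity.\<close>

lemma velocity_in_tangent_space:
  assumes lp: "local_param A \<gamma> U F" and u: "u \<in> U" and P: "P \<in> A"
  shows "frechet_derivative F (at u) v + rmult (F u) P \<in> tangent_space A \<gamma> (F u)"
proof -
  define c where "c = (\<lambda>t. rmult (F (u + t *\<^sub>R v)) (mat 1 + t *\<^sub>R P))"
  let ?Q = "\<lambda>t. mat 1 + t *\<^sub>R P"
  have Q: "?Q t \<in> A" for t using P by (intro add_in scale_in one_in)
  have "((\<lambda>t. u + t *\<^sub>R v) has_derivative (\<lambda>t. t *\<^sub>R v)) (at 0)"
    by (auto intro!: derivative_eq_intros)
  then have "((\<lambda>t. F (u + t *\<^sub>R v)) has_derivative (\<lambda>t. frechet_derivative F (at u) (t *\<^sub>R v))) (at 0)"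
    by (rule has_derivative_compose) (simp add: local_param_differentiable[OF lp u])
  moreover have "(?Q has_derivative (\<lambda>t. t *\<^sub>R P)) (at 0)"
    by (auto intro!: derivative_eq_intros)
  ultimately have "(c has_derivative (\<lambda>t. rmult (F (u + 0 *\<^sub>R v)) (t *\<^sub>R P)
      + rmult (frechet_derivative F (at u) (t *\<^sub>R v)) (?Q 0))) (at 0)"
    unfolding c_def by (rule rmult.FDERIV)
  then have D: "(c has_vector_derivative (frechet_derivative F (at u) v + rmult (F u) P)) (at 0)"
    using linear_scale[OF has_derivative_linear[OF local_param_differentiable[OF lp u]]]
    by (simp add: has_vector_derivative_def rmult.scaleR_right algebra_simps)
  have "open ((\<lambda>t. ?Q t *v axis 1 1) -` {s. is_unit_vec s})"
    by (intro open_vimage open_units)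
      (auto simp: matrix_vector_mult_add_rdistrib scaleR_matrix_vector_assoc[symmetric] intro!: continuous_intros)
  moreover have "0 \<in> (\<lambda>t. ?Q t *v axis 1 1) -` {s. is_unit_vec s}"
    by (simp add: is_unit_axis)
  ultimately have unit: "\<forall>\<^sub>F t in nhds 0. not_zero_divisor A (?Q t)"
    using Q of_column_column by (auto simp: eventually_nhds is_unit_vec_iff)
  have "open ((\<lambda>t. u + t *\<^sub>R v) -` U)"
    using lp by (intro open_vimage continuous_intros) (auto simp: local_param_def)
  then have "\<forall>\<^sub>F t in nhds 0. u + t *\<^sub>R v \<in> U"
    using u by (auto simp: eventually_nhds)
  then have "\<forall>\<^sub>F t in nhds 0. c t \<in> cone A \<gamma>"
    using unit
    by eventually_elim
      (use local_param_cone[OF lp] in \<open>auto simp: c_def cone_def rmult_coords point_rmult\<close>)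
  then show ?thesis
    unfolding tangent_space_def using D by (auto simp: c_def intro!: exI[of _ c])
qed

text \<open>Here \<open>A\<close>-smoothness enters. The velocities of the parametrization together with the multiples of
  \<open>F u\<close> form a space of dimension \<open>2 + 2\<close>, which is contained in the four-dimensional module of the
  tangent straight line. The two are therefore equal, and the lifted tangent space is closed under
  multiplication by \<open>A\<close>.\<close>

lemma tangent_space_is_module:
  assumes sl: "A_smooth_line A \<gamma>" and lp: "local_param A \<gamma> U F" and u: "u \<in> U"
  obtains X0 Y0 where "\<not> adjacent X0 Y0" "tangent_space A \<gamma> (F u) = pair_module X0 Y0" 
    "pair_module X0 Y0 = {frechet_derivative F (at u) v + rmult (F u) P | v P. P \<in> A}"
proof -
  let ?d = "frechet_derivative F (at u)"
  let ?N = "{?d v + rmult (F u) P | v P. P \<in> A}"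
  obtain X0 Y0 where XY: "X0 \<in> coords A" "Y0 \<in> coords A" "\<not> adjacent X0 Y0"
    "tangent_space A \<gamma> (F u) = tangent_space A (straight_line A X0 Y0) (F u)"
    using sl local_param_cone[OF lp u] unfolding A_smooth_line_def straight_lines_def by blast
  have sub: "?N \<subseteq> tangent_space A \<gamma> (F u)" "tangent_space A \<gamma> (F u) \<subseteq> pair_module X0 Y0"
    using velocity_in_tangent_space[OF lp u] XY tangent_space_straight_line by auto
  let ?f = "\<lambda>(v, s). ?d v + rmult (F u) (of_column s)"
  have lin: "linear ?d" by (rule has_derivative_linear[OF local_param_differentiable[OF lp u]])
  have linf: "linear ?f"
    by (rule linearI) (auto simp: linear_add[OF linear_of_column] linear_scale[OF linear_of_column]
        linear_add[OF lin] linear_scale[OF lin] rmult.add_right rmult.scaleR_right algebra_simps)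
  have "rmult (F u) P \<in> {rmult (F u) (of_column s) | s. True}" if "P \<in> A" for P
    using of_column_column[OF that] by (metis (mono_tags, lifting) mem_Collect_eq)
  then have N: "?N = range ?f"
    by (fastforce simp: image_def)
  have "v = 0 \<and> s = 0" if eq: "?d v + rmult (F u) (of_column s) = 0" for v s
  proof -
    have "?d v = rmult (F u) (of_column (- s))"
      using eq by (simp add: linear_neg[OF linear_of_column] rmult.minus_right eq_neg_iff_add_eq_0)
    then have "v = 0" using lp u unfolding local_param_def by (metis (mono_tags, lifting) of_column_in mem_Collect_eq)
    moreover from this have "act (rmult (F u) (of_column s)) (axis 1 1) = 0"
      using eq linear_0[OF lin] by (simp add: act.zero_left)
    then have "s = 0"
      using local_param_coords[OF lp u] coords_act by (simp add: act_rmult)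
    ultimately show ?thesis by simp
  qed
  then have dimN: "dim ?N = 4"
    using dim_range_full_iff_inj[OF linf] by (auto simp: N zero_prod_def)
  have "?N = pair_module X0 Y0"
  proof (rule subspace_dim_equal)
    show "subspace ?N" unfolding N by (rule linear_subspace_image[OF linf subspace_UNIV])
    show "dim (pair_module X0 Y0) \<le> dim ?N" by (simp only: dimN dim_pair_module_le)
  qed (use sub subspace_pair_module in auto)
  moreover from this have "tangent_space A \<gamma> (F u) = pair_module X0 Y0" using sub by (metis subset_antisym)
  ultimately show thesis using that XY(3) by metis
qed

text \<open>Both modules have real dimension four.\<close>

lemma tangent_space_frame:
  assumes sl: "A_smooth_line A \<gamma>" and lp: "local_param A \<gamma> U F" and u: "u \<in> U"
    and nadj: "\<not> adjacent (F u) (frechet_derivative F (at u) w)"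
  shows "tangent_space A \<gamma> (F u) = pair_module (F u) (frechet_derivative F (at u) w)"
proof -
  let ?d = "frechet_derivative F (at u)"
  obtain X0 Y0 where XY: "\<not> adjacent X0 Y0" "tangent_space A \<gamma> (F u) = pair_module X0 Y0" 
    and N: "pair_module X0 Y0 = {?d v + rmult (F u) P | v P. P \<in> A}"
    by (rule tangent_space_is_module[OF sl lp u])
  have lin: "linear ?d" by (rule has_derivative_linear[OF local_param_differentiable[OF lp u]])
  have "?d 0 + rmult (F u) (mat 1) \<in> pair_module X0 Y0" "?d w + rmult (F u) 0 \<in> pair_module X0 Y0"
    unfolding N using one_in zero_in by blast+
  then have mem: "F u \<in> pair_module X0 Y0" "?d w \<in> pair_module X0 Y0"
    by (simp_all add: linear_0[OF lin] rmult.zero_right)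
  have "pair_module (F u) (?d w) = pair_module X0 Y0"
  proof (rule subspace_dim_equal)
    show "pair_module (F u) (?d w) \<subseteq> pair_module X0 Y0"
      using mem pair_module_mult subspace_add[OF subspace_pair_module] by (fastforce simp: pair_module_def[of "F u"])
    show "dim (pair_module X0 Y0) \<le> dim (pair_module (F u) (?d w))"
      by (simp add: dim_pair_module[OF nadj] dim_pair_module_le)
  qed (rule subspace_pair_module)+
  then show ?thesis using XY by simp
qed

text \<open>The tangent module modulo the multiples of \<open>F u\<close> is free of rank one over \<open>A\<close>, generated by a
  velocity. In terms of a basis \<open>X0\<close>, \<open>Y0\<close> of the tangent module, \<open>F u\<close> has coordinates \<open>(P, Q)\<close>, and a
  second basis vector is obtained by completing this column to an invertible matrix.\<close>

lemma tangent_frame_exists: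
  assumes sl: "A_smooth_line A \<gamma>" and lp: "local_param A \<gamma> U F" and u: "u \<in> U"
  obtains w where "\<not> adjacent (F u) (frechet_derivative F (at u) w)"
proof -
  let ?d = "frechet_derivative F (at u)"
  obtain X0 Y0 where nadj: "\<not> adjacent X0 Y0" and XY: "tangent_space A \<gamma> (F u) = pair_module X0 Y0"
    and N: "pair_module X0 Y0 = {?d v + rmult (F u) P | v P. P \<in> A}"
    by (rule tangent_space_is_module[OF sl lp u])
  have lin: "linear ?d" by (rule has_derivative_linear[OF local_param_differentiable[OF lp u]])
  have "?d 0 + rmult (F u) (mat 1) \<in> pair_module X0 Y0"
    unfolding N using one_in by blast
  then obtain P Q where PQ: "P \<in> A" "Q \<in> A" "F u = rmult X0 P + rmult Y0 Q"
    by (auto simp: linear_0[OF lin] pair_module_def)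
  have "q = 0" if "P *v q = 0" "Q *v q = 0" for q
    using coords_act[OF local_param_coords[OF lp u], of q] that
    by (simp add: PQ act.add_left act_rmult act.zero_right)
  then obtain a b where ab: "a \<in> A" "b \<in> A" "not_zero_divisor A (P ** b - Q ** a)"
    using unimodular_combination PQ by metis
  have "rmult X0 a + rmult Y0 b \<in> pair_module X0 Y0"
    using ab by (auto simp: pair_module_def)
  then obtain w p where w: "p \<in> A" "rmult X0 a + rmult Y0 b = ?d w + rmult (F u) p"
    unfolding N by blast
  obtain D where D: "D ** (P ** b - Q ** a) = mat 1" using inverse_obtain[OF ab(3)] by metis
  have det_kills: "x = 0" if "(P ** b - Q ** a) *v x = 0" for x
    using D that by (metis inverse_matrix_cancel(2) matrix_vector_mult_0_right)
  have "\<not> adjacent (F u) (?d w)"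
    unfolding not_adjacent_iff
  proof (intro allI impI)
    fix s t assume eq: "act (F u) s + act (?d w) t = 0"
    \<comment> \<open>removes the multiple of \<open>F u\<close> by which \<open>?d w\<close> differs from \<open>X0 a + Y0 b\<close>\<close>
    define s' where "s' = s - p *v t"
    have "?d w = rmult X0 a + rmult Y0 b - rmult (F u) p" using w by simp
    then have "act X0 (a *v t) + act Y0 (b *v t) = act (?d w) t + act (F u) (p *v t)"
      by (simp add: act.add_left act.diff_left act_rmult)
    then have "act (F u) s' + (act X0 (a *v t) + act Y0 (b *v t)) = 0"
      using eq by (simp add: s'_def act.diff_right)
    then have "act X0 (P *v s' + a *v t) + act Y0 (Q *v s' + b *v t) = 0"
      by (simp add: PQ act.add_left act.add_right act_rmult algebra_simps)
    then have e: "P *v s' + a *v t = 0" "Q *v s' + b *v t = 0"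
      using nadj by (auto simp: not_adjacent_iff)
    have "b *v (P *v s' + a *v t) - a *v (Q *v s' + b *v t) = (b ** P) *v s' - (a ** Q) *v s' + ((b ** a) *v t - (a ** b) *v t)"
      by (simp add: matrix_vector_right_distrib matrix_vector_mul_assoc algebra_simps)
    also have "\<dots> = (P ** b - Q ** a) *v s'"
      using PQ ab by (simp add: mult_comm[of b] mult_comm[of a Q] matrix_vector_mult_diff_rdistrib)
    finally have "(P ** b - Q ** a) *v s' = 0" by (simp add: e)
    then have s0: "s' = 0" by (rule det_kills)
    then have "a *v t = 0" "b *v t = 0" using e by simp_all
    then have "(P ** b - Q ** a) *v t = 0"
      by (simp add: matrix_vector_mult_diff_rdistrib matrix_vector_mul_assoc[symmetric])
    then have "t = 0" by (rule det_kills)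
    then show "s = 0 \<and> t = 0" using s0 by (simp add: s'_def)
  qed
  then show thesis by (rule that)
qed

lemma velocity_frame:
  assumes sl: "A_smooth_line A \<gamma>" and lp: "local_param A \<gamma> U F" and u: "u \<in> U"
    and nadj: "\<not> adjacent (F u) (frechet_derivative F (at u) w)"
  obtains P Q where "P \<in> A" "Q \<in> A" 
    "frechet_derivative F (at u) v = rmult (F u) P + rmult (frechet_derivative F (at u) w) Q"
proof -
  have "frechet_derivative F (at u) v + rmult (F u) 0 \<in> pair_module (F u) (frechet_derivative F (at u) w)"
    using velocity_in_tangent_space[OF lp u zero_in, of v] by (simp only: tangent_space_frame[OF assms])
  then show thesis using that by (auto simp: pair_module_def rmult.zero_right)
qed

lemma multiple_of_velocity:
  assumes sl: "A_smooth_line A \<gamma>" and lp: "local_param A \<gamma> U F" and u: "u \<in> U" and Q: "Q \<in> A"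
  obtains w' P where "P \<in> A" 
    "rmult (frechet_derivative F (at u) w) Q = frechet_derivative F (at u) w' + rmult (F u) P"
proof -
  let ?d = "frechet_derivative F (at u)"
  obtain X0 Y0 where XY: "\<not> adjacent X0 Y0" "tangent_space A \<gamma> (F u) = pair_module X0 Y0" 
    and N: "pair_module X0 Y0 = {?d v + rmult (F u) P | v P. P \<in> A}"
    by (rule tangent_space_is_module[OF sl lp u])
  have "?d w + rmult (F u) 0 \<in> pair_module X0 Y0" unfolding N using zero_in by blast
  then have "rmult (?d w) Q \<in> pair_module X0 Y0"
    using pair_module_mult Q by (simp add: rmult.zero_right)
  then show thesis unfolding N using that by blast
qed

end

section \<open>Tangent spaces of the ruled submanifold\<close>

lemma ruled_map_derivative:
  assumes "local_param A \<gamma> U F" "u \<in> U"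
  shows "((\<lambda>(u, s). act (F u) s) has_derivative
     (\<lambda>(v, \<sigma>). act (F u) \<sigma> + act (frechet_derivative F (at u) v) s)) (at (u, s))"
proof -
  have "((\<lambda>z. F (fst z)) has_derivative (\<lambda>z. frechet_derivative F (at u) (fst z))) (at (u, s))"
    by (rule has_derivative_compose[OF has_derivative_fst[OF has_derivative_ident]])
      (simp add: local_param_differentiable[OF assms])
  from act.FDERIV[OF this has_derivative_snd[OF has_derivative_ident]]
  show ?thesis by (simp add: case_prod_beta')
qed

context plane_algebra
begin

text \<open>The candidate for the tangent space of the ruled submanifold along the generator of \<open>X\<close>: the span of
  the columns of all tangent vectors of \<open>\<gamma>\<close> at the point of \<open>X\<close>.\<close>

definition ruled_tangent :: "coord set set \<Rightarrow> coord \<Rightarrow> R6 set" where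
  "ruled_tangent \<gamma> X = {act W s | W s. W \<in> tangent_space A \<gamma> X}"

lemma ruled_tangent_rmult:
  assumes "not_zero_divisor A P"
  shows "ruled_tangent \<gamma> (rmult X P) = ruled_tangent \<gamma> X"
proof -
  have sub: "ruled_tangent \<gamma> X \<subseteq> ruled_tangent \<gamma> (rmult X P)" if P: "not_zero_divisor A P" for X P
  proof
    fix y assume "y \<in> ruled_tangent \<gamma> X"
    then obtain W s where W: "W \<in> tangent_space A \<gamma> X" "y = act W s" by (auto simp: ruled_tangent_def)
    obtain Q where "P ** Q = mat 1" using P by (metis inverse_obtain)
    then have "y = act (rmult W P) (Q *v s)"
      by (simp add: W act_rmult inverse_matrix_cancel)
    then show "y \<in> ruled_tangent \<gamma> (rmult X P)"
      using tangent_space_rmult[OF P W(1)] by (auto simp: ruled_tangent_def)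
  qed
  obtain Q where Q: "not_zero_divisor A Q" "P ** Q = mat 1" using assms by (metis inverse_obtain)
  have "ruled_tangent \<gamma> (rmult X P) \<subseteq> ruled_tangent \<gamma> (rmult (rmult X P) Q)" by (rule sub[OF Q(1)])
  then show ?thesis using sub[OF assms] by (simp add: rmult_rmult Q subset_antisym)
qed

text \<open>The construction only depends on the point and not on the parametrization, which makes the Gauss
  map well defined.\<close>

lemma ruled_tangent_point: "point A X = point A Y \<Longrightarrow> ruled_tangent \<gamma> X = ruled_tangent \<gamma> Y"
  by (auto simp: point_eq_iff ruled_tangent_rmult)

lemma ruled_tangent_frame:
  assumes sl: "A_smooth_line A \<gamma>" and lp: "local_param A \<gamma> U F" and u: "u \<in> U"
    and nadj: "\<not> adjacent (F u) (frechet_derivative F (at u) w)"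
  shows "ruled_tangent \<gamma> (F u) = range (\<lambda>(s, t). act (F u) s + act (frechet_derivative F (at u) w) t)"
    (is "_ = range ?f")
proof -
  let ?Y = "frechet_derivative F (at u) w"
  have "act (rmult (F u) P + rmult ?Y Q) r = ?f (P *v r, Q *v r)" for P Q r
    by (simp add: act.add_left act_rmult)
  then have "act (rmult (F u) P + rmult ?Y Q) r \<in> range ?f" for P Q r by blast
  moreover have "?f (s, t) = act (rmult (F u) (of_column s) + rmult ?Y (of_column t)) (axis 1 1)" for s t
    by (simp add: act.add_left act_rmult)
  then have "\<exists>W r. ?f (s, t) = act W r \<and> W \<in> pair_module (F u) ?Y" for s t
    by (metis (mono_tags, lifting) of_column_in mem_Collect_eq pair_module_def)
  ultimately show ?thesis
    unfolding ruled_tangent_def tangent_space_frame[OF assms]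
    by (auto simp: pair_module_def)
qed

lemma dim_ruled_tangent:
  assumes sl: "A_smooth_line A \<gamma>" and lp: "local_param A \<gamma> U F" and u: "u \<in> U"
  shows "subspace (ruled_tangent \<gamma> (F u))" "dim (ruled_tangent \<gamma> (F u)) = 4"
proof -
  obtain w where nadj: "\<not> adjacent (F u) (frechet_derivative F (at u) w)"
    using assms by (rule tangent_frame_exists)
  show "subspace (ruled_tangent \<gamma> (F u))"
    unfolding ruled_tangent_frame[OF assms nadj] by (rule linear_subspace_image[OF linear_act2 subspace_UNIV])
  show "dim (ruled_tangent \<gamma> (F u)) = 4"
    using nadj dim_range_full_iff_inj[OF linear_act2]
    unfolding ruled_tangent_frame[OF assms nadj] by (auto simp: not_adjacent_iff zero_prod_def)
qed

text \<open>The differential of \<open>(u, s) \<mapsto> act (F u) s\<close> only involves the vectors \<open>act (dF v) s\<close> with the given \<open>s\<close>.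
  For a unit \<open>s\<close> every vector \<open>t\<close> is \<open>Q s\<close> with \<open>Q \<in> A\<close>, and \<open>act (dF w) (Q s)\<close> belongs to the product
  \<open>dF w Q\<close>, which is again a velocity up to a multiple of \<open>F u\<close>. This is why the tangent space is the
  same at all these points of a generator.\<close>

lemma ruled_map_range_unit:
  assumes sl: "A_smooth_line A \<gamma>" and lp: "local_param A \<gamma> U F" and u: "u \<in> U" and s: "is_unit_vec s"
  shows "range (\<lambda>(v, \<sigma>). act (F u) \<sigma> + act (frechet_derivative F (at u) v) s) = ruled_tangent \<gamma> (F u)"
    (is "range ?D = _")
proof -
  obtain w where nadj: "\<not> adjacent (F u) (frechet_derivative F (at u) w)"
    using sl lp u by (rule tangent_frame_exists)
  let ?f = "\<lambda>(s, t). act (F u) s + act (frechet_derivative F (at u) w) t"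
  have "?D (v, \<sigma>) \<in> range ?f" for v \<sigma>
  proof -
    obtain P Q where "frechet_derivative F (at u) v = rmult (F u) P + rmult (frechet_derivative F (at u) w) Q"
      using velocity_frame[OF sl lp u nadj] by metis
    then have "?D (v, \<sigma>) = ?f (\<sigma> + P *v s, Q *v s)"
      by (simp add: act.add_left act.add_right act_rmult)
    then show ?thesis by blast
  qed
  moreover have "?f (\<sigma>, t) \<in> range ?D" for \<sigma> t
  proof -
    obtain Q where Q: "Q \<in> A" "Q *v s = t" using s by (rule unit_generates)
    obtain v P where v: "rmult (frechet_derivative F (at u) w) Q = frechet_derivative F (at u) v + rmult (F u) P"
      using multiple_of_velocity[OF sl lp u Q(1)] by metis
    have "act (frechet_derivative F (at u) w) t = act (rmult (frechet_derivative F (at u) w) Q) s"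
      by (simp add: act_rmult Q)
    then have "?f (\<sigma>, t) = ?D (v, \<sigma> + P *v s)"
      by (simp add: v act.add_left act.add_right act_rmult)
    then show ?thesis by blast
  qed
  ultimately show ?thesis unfolding ruled_tangent_frame[OF sl lp u nadj] by auto
qed

text \<open>If \<open>s\<close> is a zero divisor, the products \<open>Q s\<close> only fill a line, and one dimension is lost.\<close>

lemma ruled_map_range_nonunit:
  assumes sl: "A_smooth_line A \<gamma>" and lp: "local_param A \<gamma> U F" and u: "u \<in> U" and s: "\<not> is_unit_vec s"
  shows "dim (range (\<lambda>(v, \<sigma>). act (F u) \<sigma> + act (frechet_derivative F (at u) v) s)) \<noteq> 4"
    (is "dim (range ?D) \<noteq> _")
proof -
  obtain w where nadj: "\<not> adjacent (F u) (frechet_derivative F (at u) w)"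
    using sl lp u by (rule tangent_frame_exists)
  obtain r where r: "r \<noteq> 0" "of_column s *v r = 0" using s by (rule nonunit_annihilated)
  let ?f = "\<lambda>(\<sigma>, t). act (F u) \<sigma> + act (frechet_derivative F (at u) w) (of_column s *v t)"
  have lin: "linear ?f"
    by (rule linearI) (auto simp: act.add_right act.scaleR_right matrix_vector_right_distrib
      matrix_vector_mult_scaleR algebra_simps)
  have "?D (v, \<sigma>) \<in> range ?f" for v \<sigma>
  proof -
    obtain P Q where Q: "Q \<in> A" 
      and eq: "frechet_derivative F (at u) v = rmult (F u) P + rmult (frechet_derivative F (at u) w) Q"
      using velocity_frame[OF sl lp u nadj] by metis
    have "of_column s *v (Q *v axis 1 1) = Q *v s"
      using of_column_comm[of s "Q *v axis 1 1"] by (simp add: of_column_column Q)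
    then have "?D (v, \<sigma>) = ?f (\<sigma> + P *v s, Q *v axis 1 1)"
      by (simp add: eq act.add_left act.add_right act_rmult)
    then show ?thesis by blast
  qed
  then have "dim (range ?D) \<le> dim (range ?f)" by (intro dim_subset) auto
  moreover have "?f (0, r) = 0" "(0 :: real^2, r) \<noteq> 0"
    using r by (simp_all add: act.zero_right zero_prod_def)
  then have "dim (range ?f) \<noteq> DIM((real^2) \<times> (real^2))"
    unfolding dim_range_full_iff_inj[OF lin] by blast
  then have "dim (range ?f) \<noteq> 4" by simp
  moreover have "dim (range ?f) \<le> 4"
    using dim_image_le[OF lin, of UNIV] by simp
  ultimately show ?thesis by simp
qed

lemma has_tangent_iff:
  assumes sl: "A_smooth_line A \<gamma>"
  shows "has_tangent A \<gamma> x T \<longleftrightarrow>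
    (\<exists>U F u s. local_param A \<gamma> U F \<and> u \<in> U \<and> is_unit_vec s \<and> x = rp (act (F u) s) \<and> T = ruled_tangent \<gamma> (F u))"
proof
  assume "has_tangent A \<gamma> x T"
  then obtain U F u s D where lp: "local_param A \<gamma> U F" "u \<in> U" and x: "x = rp (act (F u) s)"
    and D: "((\<lambda>(u, s). act (F u) s) has_derivative D) (at (u, s))" and T: "T = range D" "dim T = 4"
    unfolding has_tangent_def by blast
  have D: "D = (\<lambda>(v, \<sigma>). act (F u) \<sigma> + act (frechet_derivative F (at u) v) s)"
    by (rule has_derivative_unique[OF D ruled_map_derivative[OF lp]])
  then have s: "is_unit_vec s" using T ruled_map_range_nonunit[OF sl lp] by metis
  then have "T = ruled_tangent \<gamma> (F u)" using T D ruled_map_range_unit[OF sl lp] by metis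
  then show "\<exists>U F u s. local_param A \<gamma> U F \<and> u \<in> U \<and> is_unit_vec s \<and> x = rp (act (F u) s) \<and> T = ruled_tangent \<gamma> (F u)"
    using lp s x by blast
next
  assume "\<exists>U F u s. local_param A \<gamma> U F \<and> u \<in> U \<and> is_unit_vec s \<and> x = rp (act (F u) s) \<and> T = ruled_tangent \<gamma> (F u)"
  then obtain U F u s where lp: "local_param A \<gamma> U F" "u \<in> U" and s: "is_unit_vec s" "x = rp (act (F u) s)"
    and T: "T = ruled_tangent \<gamma> (F u)" by blast
  show "has_tangent A \<gamma> x T"
    unfolding has_tangent_def
    using lp s(2) is_unit_vec_nonzero[OF s(1)] ruled_map_derivative[OF lp] ruled_map_range_unit[OF sl lp s(1)]
      dim_ruled_tangent[OF sl lp] T by metis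
qed

text \<open>At a regular point the position on any generator through it is a unit, so there is only one such
  generator.\<close>

lemma has_tangent_unit_position:
  assumes sl: "A_smooth_line A \<gamma>" and T: "has_tangent A \<gamma> (rp (act X s)) T"
    and X: "X \<in> coords A" and s: "s \<noteq> 0"
  shows "is_unit_vec s" "T = ruled_tangent \<gamma> X"
proof -
  obtain U F u r where lp: "local_param A \<gamma> U F" "u \<in> U" and r: "is_unit_vec r"
    and eq: "rp (act X s) = rp (act (F u) r)" and T: "T = ruled_tangent \<gamma> (F u)"
    using T unfolding has_tangent_iff[OF sl] by blast
  note * = unit_position_determines_point[OF local_param_coords[OF lp] X r s eq[symmetric]]
  show "is_unit_vec s" by (rule *(1))
  show "T = ruled_tangent \<gamma> X" unfolding T by (rule ruled_tangent_point[OF *(2)])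
qed

lemma gauss_eq:
  assumes sl: "A_smooth_line A \<gamma>" and lp: "local_param A \<gamma> U F" "u \<in> U" and s: "is_unit_vec s"
  shows "gauss A \<gamma> (rp (act (F u) s)) = ruled_tangent \<gamma> (F u)"
  unfolding gauss_def
proof (rule the_equality)
  show "has_tangent A \<gamma> (rp (act (F u) s)) (ruled_tangent \<gamma> (F u))"
    unfolding has_tangent_iff[OF sl] using lp s by blast
  show "T = ruled_tangent \<gamma> (F u)" if "has_tangent A \<gamma> (rp (act (F u) s)) T" for T
    using has_tangent_unit_position(2)[OF sl that local_param_coords[OF lp] is_unit_vec_nonzero[OF s]] .
qed

lemma tangent_constant_on_generators:
  assumes sl: "A_smooth_line A \<gamma>" and L: "L \<in> generators A \<gamma>" "x \<in> L" "y \<in> L"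
    and T: "has_tangent A \<gamma> x T" "has_tangent A \<gamma> y T'"
  shows "T = T'"
proof -
  obtain X where X: "X \<in> cone A \<gamma>" "L = generator X" using L by (auto simp: generators_def)
  then have c: "X \<in> coords A" by (simp add: cone_def)
  obtain s t where st: "s \<noteq> 0" "x = rp (act X s)" "t \<noteq> 0" "y = rp (act X t)"
    using L X by (auto simp: generator_def)
  show ?thesis
    using has_tangent_unit_position(2)[OF sl T(1)[unfolded st] c st(1)] has_tangent_unit_position(2)[OF sl T(2)[unfolded st] c st(3)]
    by simp
qed

lemma generator_has_regular_point:
  assumes sl: "A_smooth_line A \<gamma>"
  shows "three_dimensional A \<gamma>"
  unfolding three_dimensional_def
proof
  fix L assume "L \<in> generators A \<gamma>"
  then obtain X where X: "X \<in> cone A \<gamma>" "L = generator X" by (auto simp: generators_def)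
  obtain U F u where lp: "local_param A \<gamma> U F" "u \<in> U" and "point A X = point A (F u)"
    using sl X unfolding A_smooth_line_def smooth_surface_def cone_def by fastforce
  then obtain P where P: "not_zero_divisor A P" "F u = rmult X P" by (metis point_eq_iff)
  let ?x = "rp (act (F u) (axis 1 1))"
  have "P *v axis 1 1 \<noteq> 0"
    using unit_mult_unit[OF P(1) is_unit_axis] is_unit_vec_nonzero by blast
  then have "?x \<in> L" unfolding X generator_def using P by (auto simp: act_rmult)
  moreover have "regular_point A \<gamma> ?x"
    unfolding regular_point_def has_tangent_iff[OF sl] using lp is_unit_axis by blast
  ultimately show "\<exists>x\<in>L. regular_point A \<gamma> x" by blast
qed

section \<open>The differential of the Gauss map\<close>

lemma velocity_triples:
  assumes "local_param A \<gamma> U F" "u \<in> U"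
  shows "frechet_derivative F (at u) v \<in> triples"
  using eventually_in_domain[OF assms] local_param_coords[OF assms(1)] coords_triples
  by (intro has_derivative_in_subspace[OF subspace_triples _ local_param_differentiable[OF assms]])
    (auto elim: eventually_mono)

lemma second_derivative_triples:
  assumes "local_param A \<gamma> U F" "u \<in> U"
  shows "frechet_derivative (\<lambda>x. frechet_derivative F (at x) w) (at u) v \<in> triples"
  using eventually_in_domain[OF assms] velocity_triples[OF assms(1)]
  by (intro has_derivative_in_subspace[OF subspace_triples _ velocity_derivative[OF assms]])
    (auto elim: eventually_mono)

lemma sections_in_ruled_tangent:
  assumes "local_param A \<gamma> U F" "u \<in> U"
  shows "act (F u) s \<in> ruled_tangent \<gamma> (F u)" "act (frechet_derivative F (at u) w) s \<in> ruled_tangent \<gamma> (F u)"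
proof -
  have "F u \<in> tangent_space A \<gamma> (F u)"
    using velocity_in_tangent_space[OF assms one_in, of 0]
    by (simp add: linear_0[OF frechet_derivative_linear[OF assms]])
  moreover have "frechet_derivative F (at u) w \<in> tangent_space A \<gamma> (F u)"
    using velocity_in_tangent_space[OF assms zero_in, of w] by (simp add: rmult.zero_right)
  ultimately show "act (F u) s \<in> ruled_tangent \<gamma> (F u)" "act (frechet_derivative F (at u) w) s \<in> ruled_tangent \<gamma> (F u)"
    by (auto simp: ruled_tangent_def)
qed

lemma ruled_tangent_act_closed:
  assumes sl: "A_smooth_line A \<gamma>" and lp: "local_param A \<gamma> U F" and u: "u \<in> U"
    and W: "W \<in> triples" and unit: "is_unit_vec r" and mem: "act W r \<in> ruled_tangent \<gamma> (F u)"
  shows "act W s \<in> ruled_tangent \<gamma> (F u)"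
proof -
  obtain w where nadj: "\<not> adjacent (F u) (frechet_derivative F (at u) w)"
    using sl lp u by (rule tangent_frame_exists)
  let ?Y = "frechet_derivative F (at u) w"
  obtain a b where ab: "act W r = act (F u) a + act ?Y b"
    using mem unfolding ruled_tangent_frame[OF sl lp u nadj] by auto
  obtain P Q where PQ: "P \<in> A" "P *v r = a" "Q \<in> A" "Q *v r = b"
    using unit_generates[OF unit] by metis
  have "act W r = act (rmult (F u) P + rmult ?Y Q) r"
    by (simp add: ab act.add_left act_rmult PQ)
  then have "W = rmult (F u) P + rmult ?Y Q"
    using W unit PQ coords_triples[OF local_param_coords[OF lp u]] velocity_triples[OF lp u]
    by (intro act_unit_inject) (auto intro!: add_triples)
  then have "act W s = (\<lambda>(s, t). act (F u) s + act ?Y t) (P *v s, Q *v s)"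
    by (simp add: act.add_left act_rmult)
  then show ?thesis unfolding ruled_tangent_frame[OF sl lp u nadj] by blast
qed

lemma eventually_subspace_ruled_tangent:
  assumes sl: "A_smooth_line A \<gamma>" and lp: "local_param A \<gamma> U F" and u: "u \<in> U"
  shows "\<forall>\<^sub>F x in nhds u. subspace (ruled_tangent \<gamma> (F x))"
  using eventually_in_domain[OF lp u]
  by eventually_elim (simp add: dim_ruled_tangent[OF sl lp])

text \<open>The position \<open>axis 1 1\<close> is always a unit, so \<open>ruled_tangent\<close> is the injective image of a fixed
  four-dimensional space under a linear map that depends smoothly on the parameter.\<close>

lemma ruled_tangent_projection_differentiable:
  assumes sl: "A_smooth_line A \<gamma>" and lp: "local_param A \<gamma> U F" and u: "u \<in> U"
  shows "(\<lambda>x. orth_proj (ruled_tangent \<gamma> (F x))) differentiable (at u)"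
proof -
  define f where "f = (\<lambda>x (v, \<sigma>). act (F x) \<sigma> + act (frechet_derivative F (at x) v) (axis 1 1))"
  have ev: "\<forall>\<^sub>F x in nhds u. linear (f x) \<and> range (f x) = ruled_tangent \<gamma> (F x) \<and> dim (range (f x)) = DIM((real^2) \<times> (real^2))"
    using eventually_in_domain[OF lp u]
  proof eventually_elim
    case (elim x)
    have "linear (f x)"
      unfolding f_def by (rule has_derivative_linear[OF ruled_map_derivative[OF lp elim]])
    moreover have "range (f x) = ruled_tangent \<gamma> (F x)"
      unfolding f_def by (rule ruled_map_range_unit[OF sl lp elim is_unit_axis])
    ultimately show ?case using dim_ruled_tangent[OF sl lp elim] by simp
  qed
  have "(\<lambda>x. f x i) differentiable (at u)" for i
  proof (cases i)
    case (Pair v \<sigma>)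
    show ?thesis
      unfolding f_def Pair differentiable_def prod.case
      using has_derivative_add[OF
        bounded_linear.has_derivative[OF act.bounded_linear_left local_param_differentiable[OF lp u]]
        bounded_linear.has_derivative[OF act.bounded_linear_left velocity_derivative[OF lp u]]] by blast
  qed
  then have "(\<lambda>x. orth_proj (range (f x))) differentiable (at u)"
    using ev by (intro orth_proj_range_differentiable) (auto elim: eventually_mono)
  then obtain D where "((\<lambda>x. orth_proj (range (f x))) has_derivative D) (at u)"
    by (auto simp: differentiable_def)
  then have "((\<lambda>x. orth_proj (ruled_tangent \<gamma> (F x))) has_derivative D) (at u)"
  proof (rule has_derivative_transform_eventually)
    show "\<forall>\<^sub>F x in at u. orth_proj (range (f x)) = orth_proj (ruled_tangent \<gamma> (F x))"
      using ev by (auto simp: eventually_nhds_conv_at elim: eventually_mono)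
  qed (use eventually_nhds_x_imp_x[OF ev] in auto)
  then show ?thesis by (auto simp: differentiable_def)
qed

text \<open>Units form an open set, so near \<open>(u, s)\<close> the Gauss map is a function of \<open>u\<close> alone. This bounds its rank
  by two.\<close>

lemma gauss_derivative:
  assumes sl: "A_smooth_line A \<gamma>" and lp: "local_param A \<gamma> U F" and u: "u \<in> U" and s: "is_unit_vec s"
    and D: "((\<lambda>x. orth_proj (ruled_tangent \<gamma> (F x))) has_derivative D) (at u)"
  shows "((\<lambda>(u, s). orth_proj (gauss A \<gamma> (rp (act (F u) s)))) has_derivative (\<lambda>(v, \<sigma>). D v)) (at (u, s))"
proof -
  have "((\<lambda>z. orth_proj (ruled_tangent \<gamma> (F (fst z)))) has_derivative (\<lambda>z. D (fst z))) (at (u, s))"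
    by (rule has_derivative_compose[OF has_derivative_fst[OF has_derivative_ident]]) (simp add: D)
  moreover have op: "open (U \<times> {s. is_unit_vec s})"
    using lp open_units by (intro open_Times) (auto simp: local_param_def)
  moreover have "(u, s) \<in> U \<times> {s. is_unit_vec s}" using u s by simp
  moreover have "orth_proj (ruled_tangent \<gamma> (F (fst z))) = (\<lambda>(u, s). orth_proj (gauss A \<gamma> (rp (act (F u) s)))) z"
    if "z \<in> U \<times> {s. is_unit_vec s}" for z
    using that gauss_eq[OF sl lp] by auto
  ultimately have "((\<lambda>(u, s). orth_proj (gauss A \<gamma> (rp (act (F u) s)))) has_derivative (\<lambda>z. D (fst z))) (at (u, s))"
    by (rule has_derivative_transform_within_open)
  then show ?thesis by (simp add: case_prod_beta')
qed

lemma projection_derivative_on_ruled_tangent: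
  assumes sl: "A_smooth_line A \<gamma>" and lp: "local_param A \<gamma> U F" and u: "u \<in> U"
    and D: "((\<lambda>x. orth_proj (ruled_tangent \<gamma> (F x))) has_derivative D) (at u)"
  shows "D v (act (F u) r) = 0"
    and "D v (act (frechet_derivative F (at u) w) r)
        + orth_proj (ruled_tangent \<gamma> (F u)) (act (frechet_derivative (\<lambda>x. frechet_derivative F (at x) w) (at u) v) r)
      = act (frechet_derivative (\<lambda>x. frechet_derivative F (at x) w) (at u) v) r"
proof -
  let ?T = "ruled_tangent \<gamma> (F u)"
  have ev: "\<forall>\<^sub>F x in nhds u. subspace (ruled_tangent \<gamma> (F x)) \<and> act (F x) r \<in> ruled_tangent \<gamma> (F x)"
    "\<forall>\<^sub>F x in nhds u. subspace (ruled_tangent \<gamma> (F x)) \<and> act (frechet_derivative F (at x) w) r \<in> ruled_tangent \<gamma> (F x)"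
    using eventually_conj[OF eventually_in_domain[OF lp u] eventually_subspace_ruled_tangent[OF sl lp u]]
    by (auto elim!: eventually_mono simp: sections_in_ruled_tangent[OF lp])
  have "D v (act (F u) r) + orth_proj ?T (act (frechet_derivative F (at u) v) r) = act (frechet_derivative F (at u) v) r"
    by (rule projection_derivative_on_section[OF D
        bounded_linear.has_derivative[OF act.bounded_linear_left local_param_differentiable[OF lp u]] ev(1)])
  then show "D v (act (F u) r) = 0"
    by (simp add: orth_proj_fixes[OF dim_ruled_tangent(1)[OF sl lp u] sections_in_ruled_tangent(2)[OF lp u]])
  show "D v (act (frechet_derivative F (at u) w) r)
      + orth_proj ?T (act (frechet_derivative (\<lambda>x. frechet_derivative F (at x) w) (at u) v) r)
    = act (frechet_derivative (\<lambda>x. frechet_derivative F (at x) w) (at u) v) r"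
    by (rule projection_derivative_on_section[OF D
        bounded_linear.has_derivative[OF act.bounded_linear_left velocity_derivative[OF lp u]] ev(2)])
qed

text \<open>The second derivative modulo the tangent space is \<open>A\<close>-linear in the direction that was differentiated
  first. The section \<open>x \<mapsto> dF\<^sub>x w Q\<close> agrees at \<open>u\<close> with \<open>x \<mapsto> dF\<^sub>x w' + F x P\<close>, and the normal components of
  the derivatives of two sections agree when their values do; the derivative of the last summand
  is tangent.\<close>

lemma second_derivative_A_linear:
  assumes sl: "A_smooth_line A \<gamma>" and lp: "local_param A \<gamma> U F" and u: "u \<in> U"
    and eq: "rmult (frechet_derivative F (at u) w) Q = frechet_derivative F (at u) w' + rmult (F u) P"
  shows "act (frechet_derivative (\<lambda>x. frechet_derivative F (at x) w) (at u) v) (Q *v \<tau>)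
     - act (frechet_derivative (\<lambda>x. frechet_derivative F (at x) w') (at u) v) \<tau> \<in> ruled_tangent \<gamma> (F u)"
proof -
  let ?T = "ruled_tangent \<gamma> (F u)"
  let ?H = "\<lambda>w. frechet_derivative (\<lambda>x. frechet_derivative F (at x) w) (at u) v"
  obtain D where D: "((\<lambda>x. orth_proj (ruled_tangent \<gamma> (F x))) has_derivative D) (at u)"
    using ruled_tangent_projection_differentiable[OF sl lp u] by (auto simp: differentiable_def)
  have T: "subspace ?T" by (rule dim_ruled_tangent(1)[OF sl lp u])
  note 1 = projection_derivative_on_ruled_tangent(2)[OF sl lp u D] and 2 = projection_derivative_on_ruled_tangent(1)[OF sl lp u D]
  have "act (frechet_derivative F (at u) w) (Q *v \<tau>) = act (frechet_derivative F (at u) w') \<tau> + act (F u) (P *v \<tau>)"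
    by (simp add: act_rmult[symmetric] eq act.add_left)
  then have "D v (act (frechet_derivative F (at u) w) (Q *v \<tau>)) = D v (act (frechet_derivative F (at u) w') \<tau>)"
    by (simp add: blinfun.add_right 2)
  moreover have "D v (act (frechet_derivative F (at u) w) r) = act (?H w) r - orth_proj ?T (act (?H w) r)" for w r
    using 1[of v w r] by (simp add: eq_diff_eq)
  ultimately have "act (?H w) (Q *v \<tau>) - orth_proj ?T (act (?H w) (Q *v \<tau>)) = act (?H w') \<tau> - orth_proj ?T (act (?H w') \<tau>)"
    by metis
  then have "orth_proj ?T (act (?H w) (Q *v \<tau>) - act (?H w') \<tau>) = act (?H w) (Q *v \<tau>) - act (?H w') \<tau>"
    by (simp add: blinfun.diff_right algebra_simps)
  then show ?thesis using orth_proj_char(1)[OF T] by metis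
qed

text \<open>The tangent spaces are spanned by the sections \<open>F\<close> and \<open>dF w\<close>. The derivatives of \<open>F\<close> are always tangent, so
  the differential of the Gauss map vanishes on \<open>v\<close> exactly if the derivatives of all \<open>dF w\<close> along \<open>v\<close> are
  tangent.\<close>

lemma gauss_kernel_iff:
  assumes sl: "A_smooth_line A \<gamma>" and lp: "local_param A \<gamma> U F" and u: "u \<in> U"
    and D: "((\<lambda>x. orth_proj (ruled_tangent \<gamma> (F x))) has_derivative D) (at u)"
  shows "D v = 0 \<longleftrightarrow> (\<forall>w \<tau>. act (frechet_derivative (\<lambda>x. frechet_derivative F (at x) w) (at u) v) \<tau> \<in> ruled_tangent \<gamma> (F u))"
proof -
  let ?T = "ruled_tangent \<gamma> (F u)"
  let ?H = "\<lambda>w. frechet_derivative (\<lambda>x. frechet_derivative F (at x) w) (at u) v"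
  have T: "subspace ?T" by (rule dim_ruled_tangent(1)[OF sl lp u])
  note 1 = projection_derivative_on_ruled_tangent(2)[OF sl lp u D] and 2 = projection_derivative_on_ruled_tangent(1)[OF sl lp u D]
  show ?thesis
  proof
    assume "D v = 0"
    then have "act (?H w) \<tau> = orth_proj ?T (act (?H w) \<tau>)" for w \<tau> using 1[of v w \<tau>] by simp
    then show "\<forall>w \<tau>. act (?H w) \<tau> \<in> ?T" using orth_proj_char(1)[OF T] by metis
  next
    assume mem: "\<forall>w \<tau>. act (?H w) \<tau> \<in> ?T"
    show "D v = 0"
    proof (rule projection_derivative_zero[OF D])
      show "\<forall>\<^sub>F x in nhds u. subspace (ruled_tangent \<gamma> (F x))"
        by (rule eventually_subspace_ruled_tangent[OF sl lp u])
      fix y assume "y \<in> ?T"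
      then obtain v' \<sigma> where y: "y = act (F u) \<sigma> + act (frechet_derivative F (at u) v') (axis 1 1)"
        unfolding ruled_map_range_unit[OF sl lp u is_unit_axis, symmetric] by auto
      have "D v (act (frechet_derivative F (at u) v') (axis 1 1)) = 0"
        using 1[of v v' "axis 1 1"] mem by (simp add: orth_proj_fixes[OF T])
      then show "D v y = 0" by (simp add: y blinfun.add_right 2)
    qed
  qed
qed

text \<open>Write \<open>H v w\<close> for the derivative along \<open>v\<close> of the velocity in the direction \<open>w\<close>. Modulo
  multiples of \<open>F u\<close> the velocities form a free module of rank one, and the second derivative
  modulo the tangent space is linear over \<open>A\<close> in one argument and symmetric, hence bilinear over \<open>A\<close>. With
  a generator \<open>w\<close> and \<open>n = H w w\<close> the form \<open>H\<close> is \<open>(w a, w b) \<mapsto> n a b\<close>. Thus \<open>w a\<close> is in the kernel of the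
  differential of the Gauss map iff \<open>n a\<close> is tangent, and the kernel is trivial iff \<open>n\<close> generates the
  two-dimensional quotient by the tangent space, that is, iff \<open>F u\<close>, \<open>dF w\<close> and \<open>n\<close> have columns of
  rank six.\<close>

lemma gauss_injective_iff_curved:
  assumes sl: "A_smooth_line A \<gamma>" and lp: "local_param A \<gamma> U F" and u: "u \<in> U"
    and D: "((\<lambda>x. orth_proj (ruled_tangent \<gamma> (F x))) has_derivative D) (at u)"
  shows "(\<forall>v. D v = 0 \<longrightarrow> v = 0) \<longleftrightarrow>
     (\<exists>v. dim (cols (F u) \<union> cols (frechet_derivative F (at u) v)
         \<union> cols (frechet_derivative (\<lambda>x. frechet_derivative F (at x) v) (at u) v)) = 6)"
    (is "?L \<longleftrightarrow> ?R")
proof -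
  let ?T = "ruled_tangent \<gamma> (F u)"
  let ?d = "frechet_derivative F (at u)"
  define H where "H = (\<lambda>v w. frechet_derivative (\<lambda>x. frechet_derivative F (at x) w) (at u) v)"
  have T: "subspace ?T" by (rule dim_ruled_tangent(1)[OF sl lp u])
  have sym: "H v w = H w v" for v w
    unfolding H_def
    using lp u by (intro second_derivative_symmetric[of U]) (auto simp only: local_param_def smooth_on_def)
  have H: "frechet_derivative (\<lambda>x. frechet_derivative F (at x) w) (at u) v = H v w" for v w
    by (simp add: H_def)
  note lin = second_derivative_A_linear[OF sl lp u, unfolded H]
  note ker = gauss_kernel_iff[OF sl lp u D, unfolded H]
  have Ht: "H v w \<in> triples" for v w unfolding H_def by (rule second_derivative_triples[OF lp u])
  have R: "?R \<longleftrightarrow> (\<exists>v. \<forall>s t r. act (F u) s + act (?d v) t + act (H v v) r = 0 \<longrightarrow> s = 0 \<and> t = 0 \<and> r = 0)"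
    by (simp only: dim_cols3_iff H_def)
  have dlin: "linear ?d" by (rule frechet_derivative_linear[OF lp u])
  have velocity_vertical: "v = 0" if "P \<in> A" "?d v = rmult (F u) P" for v P
    using lp u that unfolding local_param_def by blast
  show ?thesis
    unfolding R
  proof
    assume inj: ?L
    obtain w where nadj: "\<not> adjacent (F u) (?d w)" using sl lp u by (rule tangent_frame_exists)
    show "\<exists>v. \<forall>s t r. act (F u) s + act (?d v) t + act (H v v) r = 0 \<longrightarrow> s = 0 \<and> t = 0 \<and> r = 0"
    proof (intro exI[of _ w] allI impI)
      fix s t r assume zero: "act (F u) s + act (?d w) t + act (H w w) r = 0"
      have "act (H w w) r = - (act (F u) s + act (?d w) t)"
        using zero by (simp only: add_eq_0_iff)
      then have mem: "act (H w w) r \<in> ?T"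
        using sections_in_ruled_tangent[OF lp u] by (metis subspace_neg[OF T] subspace_add[OF T])
      \<comment> \<open>\<open>w'\<close> is the direction \<open>w r\<close>; it turns out to lie in the kernel.\<close>
      obtain w' P where w': "P \<in> A" "rmult (?d w) (of_column r) = ?d w' + rmult (F u) P"
        using multiple_of_velocity[OF sl lp u of_column_in] by metis
      have "act (H w w) r - act (H w w') (axis 1 1) \<in> ?T"
        using lin[OF w'(2), of w "axis 1 1"] by simp
      from subspace_diff[OF T mem this] have "act (H w' w) (axis 1 1) \<in> ?T"
        by (simp add: sym[of w' w])
      then have mem': "act (H w' w) \<tau> \<in> ?T" for \<tau>
        by (rule ruled_tangent_act_closed[OF sl lp u Ht is_unit_axis])
      have "act (H w' x) \<tau> \<in> ?T" for x \<tau>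
      proof -
        obtain P' Q where PQ: "P' \<in> A" "Q \<in> A" "?d x = rmult (F u) P' + rmult (?d w) Q"
          using velocity_frame[OF sl lp u nadj] by metis
        have "rmult (?d w) Q = ?d x + rmult (F u) (- P')"
          by (simp add: PQ rmult.minus_right)
        from lin[OF this, of w' \<tau>] have "act (H w' w) (Q *v \<tau>) - act (H w' x) \<tau> \<in> ?T" .
        from subspace_diff[OF T mem'[of "Q *v \<tau>"] this] show ?thesis by simp
      qed
      then have "w' = 0" using inj ker by blast
      then have "rmult (?d w) (of_column r) = rmult (F u) P" using w' by (simp add: linear_0[OF dlin])
      then have "act (rmult (F u) P) (axis 1 1) = act (rmult (?d w) (of_column r)) (axis 1 1)" by simp
      then have "act (F u) (- (P *v axis 1 1)) + act (?d w) r = 0"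
        by (simp add: act_rmult act.minus_right)
      then have "r = 0" using nadj by (simp add: not_adjacent_iff)
      then show "s = 0 \<and> t = 0 \<and> r = 0"
        using zero nadj by (simp add: not_adjacent_iff act.zero_right)
    qed
  next
    assume "\<exists>v. \<forall>s t r. act (F u) s + act (?d v) t + act (H v v) r = 0 \<longrightarrow> s = 0 \<and> t = 0 \<and> r = 0"
    then obtain v where free: "\<And>s t r. act (F u) s + act (?d v) t + act (H v v) r = 0 \<Longrightarrow> s = 0 \<and> t = 0 \<and> r = 0"
      by metis
    have nadj: "\<not> adjacent (F u) (?d v)"
      unfolding not_adjacent_iff using free[of _ _ 0] by (simp add: act.zero_right)
    show ?L
    proof (intro allI impI)
      fix w assume "D w = 0"
      then have "act (H v w) (axis 1 1) \<in> ?T" using ker by (metis sym)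
      obtain P Q where PQ: "P \<in> A" "Q \<in> A" "?d w = rmult (F u) P + rmult (?d v) Q"
        using velocity_frame[OF sl lp u nadj] by metis
      have "rmult (?d v) Q = ?d w + rmult (F u) (- P)"
        by (simp add: PQ rmult.minus_right)
      from lin[OF this, of v "axis 1 1"]
      have "act (H v v) (Q *v axis 1 1) - act (H v w) (axis 1 1) \<in> ?T" .
      from subspace_add[OF T this \<open>act (H v w) (axis 1 1) \<in> ?T\<close>]
      have "act (H v v) (Q *v axis 1 1) \<in> ?T" by simp
      then obtain s t where "act (H v v) (Q *v axis 1 1) = act (F u) s + act (?d v) t"
        unfolding ruled_tangent_frame[OF sl lp u nadj] by auto
      then have "act (F u) (- s) + act (?d v) (- t) + act (H v v) (Q *v axis 1 1) = 0"
        by (simp add: act.minus_right)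
      then have "Q *v axis 1 1 = 0" using free by blast
      then have "Q = 0" using PQ zero_in by (intro eq_if_first_column_eq) auto
      then show "w = 0" using PQ velocity_vertical by (simp add: rmult.zero_right)
    qed
  qed
qed

section \<open>Rank of the Gauss map and inflection points\<close>

lemma gauss_rank_at_unit_position:
  assumes sl: "A_smooth_line A \<gamma>" and lp: "local_param A \<gamma> U F" and u: "u \<in> U" and s: "is_unit_vec s"
  shows "\<exists>r\<le>2. gauss_rank A \<gamma> (rp (act (F u) s)) r"
    and "(\<exists>v. dim (cols (F u) \<union> cols (frechet_derivative F (at u) v)
         \<union> cols (frechet_derivative (\<lambda>x. frechet_derivative F (at x) v) (at u) v)) = 6)
       \<Longrightarrow> gauss_rank A \<gamma> (rp (act (F u) s)) 2"
proof -
  obtain D where D: "((\<lambda>x. orth_proj (ruled_tangent \<gamma> (F x))) has_derivative D) (at u)"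
    using ruled_tangent_projection_differentiable[OF sl lp u] by (auto simp: differentiable_def)
  have "range (\<lambda>(v::real^2, \<sigma>::real^2). D v) = range D" by auto
  then have rank: "gauss_rank A \<gamma> (rp (act (F u) s)) (dim (range D))"
    unfolding gauss_rank_def
    using lp u is_unit_vec_nonzero[OF s] gauss_derivative[OF sl lp u s D] by metis
  show "\<exists>r\<le>2. gauss_rank A \<gamma> (rp (act (F u) s)) r" using rank dim_range_le[OF has_derivative_linear[OF D]] by auto
  show "gauss_rank A \<gamma> (rp (act (F u) s)) 2"
    if "\<exists>v. dim (cols (F u) \<union> cols (frechet_derivative F (at u) v)
         \<union> cols (frechet_derivative (\<lambda>x. frechet_derivative F (at x) v) (at u) v)) = 6"
    using rank dim_range_full_iff_inj[OF has_derivative_linear[OF D]] that unfolding gauss_injective_iff_curved[OF sl lp u D, symmetric] by simp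
qed

lemma gauss_rank_2_imp_curved:
  assumes sl: "A_smooth_line A \<gamma>" and reg: "regular_point A \<gamma> x" and rank: "gauss_rank A \<gamma> x 2"
  obtains U F u s v where "local_param A \<gamma> U F" "u \<in> U" "s \<noteq> 0" "x = rp (act (F u) s)"
    "dim (cols (F u) \<union> cols (frechet_derivative F (at u) v)
         \<union> cols (frechet_derivative (\<lambda>x. frechet_derivative F (at x) v) (at u) v)) = 6"
proof -
  obtain U F u s D where lp: "local_param A \<gamma> U F" "u \<in> U" and s: "s \<noteq> 0" and x: "x = rp (act (F u) s)"
    and D: "((\<lambda>(u, s). orth_proj (gauss A \<gamma> (rp (act (F u) s)))) has_derivative D) (at (u, s))"
    and r: "dim (range D) = 2"
    using rank unfolding gauss_rank_def by blast
  obtain T where "has_tangent A \<gamma> x T" using reg by (auto simp: regular_point_def)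
  then have unit: "is_unit_vec s"
    using has_tangent_unit_position(1)[OF sl _ local_param_coords[OF lp] s] x by blast
  obtain D' where D': "((\<lambda>x. orth_proj (ruled_tangent \<gamma> (F x))) has_derivative D') (at u)"
    using ruled_tangent_projection_differentiable[OF sl lp] by (auto simp: differentiable_def)
  have "D = (\<lambda>(v, \<sigma>). D' v)"
    by (rule has_derivative_unique[OF D gauss_derivative[OF sl lp unit D']])
  then have "range D = range D'" by auto
  then have "\<forall>v. D' v = 0 \<longrightarrow> v = 0"
    using r dim_range_full_iff_inj[OF has_derivative_linear[OF D']] by simp
  then show thesis
    unfolding gauss_injective_iff_curved[OF sl lp D'] using that lp s x by blast
qed

text \<open>The two parametrizations that witness the rank of the Gauss map and the absence of an inflection
  need not agree. They represent the same point because a regular point lies on only one generator.\<close>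

lemma rank_2_iff_no_inflection:
  assumes sl: "A_smooth_line A \<gamma>"
  shows "tangentially_degenerate A \<gamma> 2 \<longleftrightarrow> (\<forall>p\<in>\<gamma>. \<not> inflection_point A \<gamma> p)"
proof
  assume td: "tangentially_degenerate A \<gamma> 2"
  show "\<forall>p\<in>\<gamma>. \<not> inflection_point A \<gamma> p"
  proof
    fix p assume "p \<in> \<gamma>"
    then obtain U F u where lp: "local_param A \<gamma> U F" "u \<in> U" and p: "p = point A (F u)"
      using sl unfolding A_smooth_line_def smooth_surface_def by fastforce
    let ?x = "rp (act (F u) (axis 1 1))"
    have "?x \<in> generator (F u)" using is_unit_vec_nonzero[OF is_unit_axis] unfolding generator_def by blast
    then have "?x \<in> ruled A \<gamma>"
      using local_param_cone[OF lp] unfolding ruled_def generators_def by blast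
    moreover have reg: "regular_point A \<gamma> ?x"
      unfolding regular_point_def has_tangent_iff[OF sl] using lp is_unit_axis by blast
    ultimately have "gauss_rank A \<gamma> ?x 2" using td by (simp add: tangentially_degenerate_def)
    from gauss_rank_2_imp_curved[OF sl reg this]
    obtain U' F' u' s v where lp': "local_param A \<gamma> U' F'" "u' \<in> U'" and s: "s \<noteq> 0" "?x = rp (act (F' u') s)"
      and full: "dim (cols (F' u') \<union> cols (frechet_derivative F' (at u') v)
         \<union> cols (frechet_derivative (\<lambda>x. frechet_derivative F' (at x) v) (at u') v)) = 6" by metis
    have "point A (F u) = point A (F' u')"
      by (rule unit_position_determines_point(2)[OF local_param_coords[OF lp] local_param_coords[OF lp'] is_unit_axis s])
    then show "\<not> inflection_point A \<gamma> p"
      unfolding inflection_point_def p using lp' full by metis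
  qed
next
  assume noinf: "\<forall>p\<in>\<gamma>. \<not> inflection_point A \<gamma> p"
  have "gauss_rank A \<gamma> x 2" if reg: "regular_point A \<gamma> x" for x
  proof -
    obtain U F u s where lp: "local_param A \<gamma> U F" "u \<in> U" and s: "is_unit_vec s" "x = rp (act (F u) s)"
      using reg unfolding regular_point_def has_tangent_iff[OF sl] by blast
    have mem: "point A (F u) \<in> \<gamma>" using local_param_cone[OF lp] by (simp add: cone_def)
    then have "\<not> inflection_point A \<gamma> (point A (F u))" using noinf by blast
    then obtain U' F' u' v where lp': "local_param A \<gamma> U' F'" "u' \<in> U'" and pt: "point A (F' u') = point A (F u)"
      and full: "dim (cols (F' u') \<union> cols (frechet_derivative F' (at u') v)
         \<union> cols (frechet_derivative (\<lambda>x. frechet_derivative F' (at x) v) (at u') v)) = 6"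
      using mem unfolding inflection_point_def by blast
    obtain P where P: "not_zero_divisor A P" "F u = rmult (F' u') P" using pt by (metis point_eq_iff)
    have "x = rp (act (F' u') (P *v s))" by (simp add: s P act_rmult)
    then show ?thesis
      using gauss_rank_at_unit_position(2)[OF sl lp' unit_mult_unit[OF P(1) s(1)]] full by blast
  qed
  then show "tangentially_degenerate A \<gamma> 2"
    unfolding tangentially_degenerate_def using generator_has_regular_point[OF sl] by simp
qed

end

theorem theorem2:
  fixes A :: "(real^2^2) set" and \<gamma> :: "coord set set"
  assumes "A = alg_C \<or> A = alg_C1 \<or> A = alg_C0"
    and "A_smooth_line A \<gamma>"
  shows "(\<forall>L\<in>generators A \<gamma>. \<forall>x\<in>L. \<forall>y\<in>L. \<forall>T T'.
            has_tangent A \<gamma> x T \<longrightarrow> has_tangent A \<gamma> y T' \<longrightarrow> T = T')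
       \<and> three_dimensional A \<gamma>
       \<and> (\<forall>x\<in>ruled A \<gamma>. regular_point A \<gamma> x \<longrightarrow> (\<exists>r\<le>2. gauss_rank A \<gamma> x r))
       \<and> (tangentially_degenerate A \<gamma> 2 \<longleftrightarrow> (\<forall>p\<in>\<gamma>. \<not> inflection_point A \<gamma> p))"
proof -
  interpret plane_algebra A by (rule plane_algebra_alg[OF assms(1)])
  have "\<exists>r\<le>2. gauss_rank A \<gamma> x r" if "regular_point A \<gamma> x" for x
    using that gauss_rank_at_unit_position(1)[OF assms(2)]
    unfolding regular_point_def has_tangent_iff[OF assms(2)] by blast
  then show ?thesis
    using tangent_constant_on_generators[OF assms(2)] generator_has_regular_point[OF assms(2)]
      rank_2_iff_no_inflection[OF assms(2)] by blast
qed

end
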